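(* Let $n\ge 1$ and let $F$ satisfy the standing assumptions below together with the smallness-of-third-derivatives condition (SC) with a constant $C_1$ satisfying $C_1^2<4n^{-1/2}$. Let $T>0$, $M>0$, and let $u:\mathbb{R}^n\times[0,T]\to\mathbb{R}$ be a $C^3$ solution of the anisotropic mean curvature flow equation (AMCF) with $|u(x,t)|\le M$ for all $(x,t)$, which is periodic with respect to a lattice $L\subset\mathbb{R}^n$, i.e. $u(x+\ell,t)=u(x,t)$ for all $\ell\in L$. Then there are constants $A>0$, $P>F(-\phi^0)$ and $q>1$ depending only on $F$ (and $n$, $C_1$), and a time $T'\in(0,T]$ depending on $M$ (and $A$), such that $$F(Du-\phi^0)(x,t)\le \max\left\{ t^{q/2}\exp\!\left(\frac{Aq\,(|u(x,t)|-2M)^2}{4t}\right),\ P\right\}$$ for all $x\in\mathbb{R}^n$ and all $0<t\le T'$.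
   Context: Let $V\cong\mathbb{R}^{n+1}$ with basis $e_0,e_1,\dots,e_n$ and let $V^*$ have the dual basis $\phi^0,\phi^1,\dots,\phi^n$. Standing assumptions on $F$: $F:V^*\to\mathbb{R}$ is positive (on $V^*\setminus\{0\}$), convex, $C^3$ on $V^*\setminus\{0\}$, homogeneous of degree one ($F(\lambda v)=\lambda F(v)$ for $\lambda>0$), and each sublevel set $\{v\in V^*: F(v)\le\lambda\}$ is uniformly convex. Write $\Sigma_\lambda=\{v: F(v)=\lambda\}$; a vector $p\in V^*$ is tangent to $\Sigma_{F(\nu)}$ at $\nu$ iff $DF|_\nu(p)=0$. $D^kF|_\nu$ denotes the $k$-th derivative of $F$ at $\nu$ as a symmetric $k$-linear form on $V^*$. For a function $u(y,t)$, $y=(y^1,\dots,y^n)\in\mathbb{R}^n$, write $u_i=\partial u/\partial y^i$, $u_{ij}=\partial^2u/\partial y^i\partial y^j$, $Du=\sum_{i=1}^n u_i\phi^i\in V^*$. The anisotropic mean curvature flow equation (AMCF) is $$u_t=\sum_{i,j=1}^n F(\nu)\,D^2F|_{\nu}(\phi^i,\phi^j)\,u_{ij},\qquad \nu=Du-\phi^0 .$$ Smallness-of-third-derivatives condition (SC) with constant $C_1>0$: for every $\nu\in V^*\setminus\{0\}$ and all $p,q,r\in V^*$ tangent to $\Sigma_{F(\nu)}$ at $\nu$, $$F(\nu)^2D^3F|_\nu(p,q,r)\le C_1\Big[F(\nu)^3\,D^2F|_\nu(p,p)\,D^2F|_\nu(q,q)\,D^2F|_\nu(r,r)\Big]^{1/2}.$$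 *)

theory Defs
  imports "HOL-Analysis.Analysis"
begin

text \<open>Derivatives of a real-valued function on a normed space, taken within a set S
  (for open S this is the ordinary Frechet derivative; for S = R^n x [0,T] it gives
  one-sided derivatives at t = 0 and t = T). D1 f S x p = Df|_x(p),
  D2 f S x p q = D^2 f|_x(p,q), D3 f S x p q r = D^3 f|_x(p,q,r).\<close>

definition D1 :: "('a::real_normed_vector \<Rightarrow> real) \<Rightarrow> 'a set \<Rightarrow> 'a \<Rightarrow> 'a \<Rightarrow> real" where
  "D1 f S x p = frechet_derivative f (at x within S) p"

definition D2 :: "('a::real_normed_vector \<Rightarrow> real) \<Rightarrow> 'a set \<Rightarrow> 'a \<Rightarrow> 'a \<Rightarrow> 'a \<Rightarrow> real" where
  "D2 f S x p q = frechet_derivative (\<lambda>y. D1 f S y p) (at x within S) q"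

definition D3 :: "('a::real_normed_vector \<Rightarrow> real) \<Rightarrow> 'a set \<Rightarrow> 'a \<Rightarrow> 'a \<Rightarrow> 'a \<Rightarrow> 'a \<Rightarrow> real" where
  "D3 f S x p q r = frechet_derivative (\<lambda>y. D2 f S y p q) (at x within S) r"

definition C3_on :: "('a::real_normed_vector \<Rightarrow> real) \<Rightarrow> 'a set \<Rightarrow> bool" where
  "C3_on f S \<longleftrightarrow>
     (\<forall>x\<in>S. f differentiable (at x within S)
        \<and> (\<forall>p. (\<lambda>y. D1 f S y p) differentiable (at x within S))
        \<and> (\<forall>p q. (\<lambda>y. D2 f S y p q) differentiable (at x within S)))
     \<and> (\<forall>p q r. continuous_on S (\<lambda>y. D3 f S y p q r))"

definition uniformly_convex_set :: "'a::real_normed_vector set \<Rightarrow> bool" where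
  "uniformly_convex_set K \<longleftrightarrow> convex K \<and>
     (\<exists>c>0. \<forall>x\<in>K. \<forall>y\<in>K. ball ((1/2) *\<^sub>R (x + y)) (c * (norm (x - y))\<^sup>2) \<subseteq> K)"

definition is_lattice :: "(real^'n) set \<Rightarrow> bool" where
  "is_lattice L \<longleftrightarrow> (\<exists>B :: real^'n^'n. invertible B \<and>
      L = {B *v k | k. \<forall>i. k $ i \<in> \<int>})"

text \<open>V^* = R x R^n, with phi^0 = (1,0) and phi^i = (0, e_i).\<close>
definition phi0 :: "real \<times> (real^'n)" where "phi0 = (1, 0)"
definition phi :: "'n \<Rightarrow> real \<times> (real^'n)" where "phi i = (0, axis i 1)"

definition standing_F :: "(real \<times> (real^'n) \<Rightarrow> real) \<Rightarrow> bool" where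
  "standing_F F \<longleftrightarrow>
     (\<forall>v. v \<noteq> 0 \<longrightarrow> F v > 0)
   \<and> convex_on UNIV F
   \<and> C3_on F (- {0})
   \<and> (\<forall>lam>0. \<forall>v. F (lam *\<^sub>R v) = lam * F v)
   \<and> (\<forall>lam. uniformly_convex_set {v. F v \<le> lam})"

definition SC :: "(real \<times> (real^'n) \<Rightarrow> real) \<Rightarrow> real \<Rightarrow> bool" where
  "SC F C1 \<longleftrightarrow> (\<forall>\<nu> p q r. \<nu> \<noteq> 0 \<longrightarrow>
      D1 F (- {0}) \<nu> p = 0 \<longrightarrow> D1 F (- {0}) \<nu> q = 0 \<longrightarrow> D1 F (- {0}) \<nu> r = 0 \<longrightarrow>
      (F \<nu>)\<^sup>2 * D3 F (- {0}) \<nu> p q r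
        \<le> C1 * sqrt ((F \<nu>) ^ 3 * D2 F (- {0}) \<nu> p p * D2 F (- {0}) \<nu> q q * D2 F (- {0}) \<nu> r r))"

definition nu_of :: "((real^'n) \<times> real \<Rightarrow> real) \<Rightarrow> real \<Rightarrow> real^'n \<Rightarrow> real \<Rightarrow> real \<times> (real^'n)" where
  "nu_of u T x t =
     (\<Sum>i\<in>UNIV. D1 u (UNIV \<times> {0..T}) (x, t) (axis i 1, 0) *\<^sub>R phi i) - phi0"

definition solves_AMCF :: "(real \<times> (real^'n) \<Rightarrow> real) \<Rightarrow> ((real^'n) \<times> real \<Rightarrow> real) \<Rightarrow> real \<Rightarrow> bool" where
  "solves_AMCF F u T \<longleftrightarrow> (\<forall>x t. 0 \<le> t \<and> t \<le> T \<longrightarrow>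
     D1 u (UNIV \<times> {0..T}) (x, t) (0, 1) =
       (\<Sum>i\<in>UNIV. \<Sum>j\<in>UNIV. F (nu_of u T x t) * D2 F (- {0}) (nu_of u T x t) (phi i) (phi j)
            * D2 u (UNIV \<times> {0..T}) (x, t) (axis i 1, 0) (axis j 1, 0)))"

end

theory Submission
  imports Defs
begin

text \<open>The estimate comes from a two-point maximum principle. By uniform convexity of the sublevel sets, the
  coefficient matrix at gradient p, restricted to any direction, dominates c / (1 + |p|^2) times the projection
  onto p. Hence, if G(z, t) is increasing in z and a strict subsolution of the one-dimensional equation
  G_t = c G_zz / (1 + G_z^2), the inequality G((u(x,t) - u(y,t)) / 2, t) <= |x - y| / 2 cannot fail for a first
  time. The choice G(z, t) = exp(-(2M - z)^2 / (c t)) - exp(-4 M^2 / (c t)) tends to 0 as t tends to 0, so no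
  information on the initial gradient enters. Letting y tend to x gives
  |Du| <= (c t / 4M) exp(4 M^2 / (c t)), which is below t exp(8 M^2 / (c t)) for small t.\<close>

section \<open>Calculus\<close>

text \<open>Homogeneity makes \<open>D2 F\<close> vanish in the radial direction, so no uniform
  ellipticity can be expected: as for mean curvature flow, the available lower bound is lost where
  the graph is steep. The remedy is to exchange the roles of height and distance. At a touching
  point the common gradient p has length 1 / G_z, so the weak factor c / (1 + |p|^2) becomes c G_z^2
  / (1 + G_z^2), while the chain rule produces G_zz / G_z^2. In the product the squares of G_z
  cancel, and steep graphs, which correspond to small G_z, are harmless: as long as G_z \<le> 1 the
  coefficient of G_zz lies between c / 2 and c. The Gaussian in G has no factor t^(-1/2), so it is
  not a heat kernel. For diffusivity c / 2 the kernel would have the exponent -(2M - z)^2 / (2 c t);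
  the doubled rate 1 / c gives a surplus in G_zz that pays for the missing factor, because 2M - z
  \<ge> M keeps away from the centre.\<close>

lemma second_derivative_test_min:
  fixes f :: "real \<Rightarrow> real"
  assumes d: "d > 0"
    and f': "\<And>s. \<bar>s\<bar> < d \<Longrightarrow> (f has_real_derivative f' s) (at s)"
    and f'': "(f' has_real_derivative D) (at 0)"
    and min: "\<And>s. \<bar>s\<bar> < d \<Longrightarrow> f 0 \<le> f s"
  shows "f' 0 = 0" "D \<ge> 0"
proof -
  show 0: "f' 0 = 0"
    using DERIV_local_min[OF f'[of 0] d] d min by auto
  show "D \<ge> 0"
  proof (rule ccontr)
    assume "\<not> D \<ge> 0"
    then obtain e where e: "e > 0" "\<And>h. h > 0 \<Longrightarrow> h < e \<Longrightarrow> f' 0 > f' (0 + h)"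
      using DERIV_neg_dec_right[OF f''] by force
    define h where "h = min d e / 2"
    have h: "0 < h" "h < d" "h < e" using d e by (auto simp: h_def)
    obtain z where z: "0 < z" "z < h" "f h - f 0 = (h - 0) * f' z"
      using MVT2[of 0 h f f'] h f' by (metis abs_of_nonneg order_le_less_trans)
    have "f' z < 0" using e(2)[of z] z h 0 by auto
    then have "f h < f 0" using z h by (smt (verit) mult_pos_neg)
    with min[of h] h show False by auto
  qed
qed

text \<open>Pivot elimination in place of diagonalisation. The set \<open>I\<close> contains the
  rows of \<open>P\<close> that may be nonzero. Subtracting the rank-one matrix built from row
  \<open>s\<close> leaves a semidefinite matrix whose row \<open>s\<close> vanishes, and the
  rank-one part pairs with \<open>H\<close> to the form of \<open>H\<close> at that row.\<close>

lemma trace_psd_nonneg_aux: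
  fixes P H :: "'n::finite \<Rightarrow> 'n \<Rightarrow> real"
  assumes "finite I"
    and "\<And>i j. P i j = P j i"
    and "\<And>v. 0 \<le> (\<Sum>i\<in>UNIV. \<Sum>j\<in>UNIV. P i j * v i * v j)"
    and H: "\<And>v. 0 \<le> (\<Sum>i\<in>UNIV. \<Sum>j\<in>UNIV. H i j * v i * v j)"
    and "\<And>i j. i \<notin> I \<Longrightarrow> P i j = 0"
  shows "0 \<le> (\<Sum>i\<in>UNIV. \<Sum>j\<in>UNIV. P i j * H i j)"
  using assms(1,2,3,5)
proof (induction I arbitrary: P rule: finite_induct)
  case empty
  then show ?case by simp
next
  case (insert s I)
  note sym = insert.prems(1) and psd = insert.prems(2) and supp = insert.prems(3)
  have expand: "(\<Sum>i\<in>UNIV. \<Sum>j\<in>UNIV. P i j * (v i + x * (if i = s then 1 else 0)) * (v j + x * (if j = s then 1 else 0)))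
      = (\<Sum>i\<in>UNIV. \<Sum>j\<in>UNIV. P i j * v i * v j) + 2 * x * (\<Sum>j\<in>UNIV. P s j * v j) + x\<^sup>2 * P s s"
    for v x
  proof -
    have "P i j * (v i + x * (if i = s then 1 else 0)) * (v j + x * (if j = s then 1 else 0))
      = P i j * v i * v j + x * (if i = s then P s j * v j else 0) + x * (if j = s then P s i * v i else 0)
        + x\<^sup>2 * (if i = s then (if j = s then P s s else 0) else 0)" for i j
      using sym by (auto simp: algebra_simps power2_eq_square)
    moreover have "(\<Sum>i\<in>UNIV. \<Sum>j\<in>UNIV. (if i = s then g j else 0)) = (\<Sum>j\<in>UNIV. g j)" for g :: "'n \<Rightarrow> real"
      by (subst sum.swap) simp
    ultimately show ?thesis
      by (simp add: sum.distrib sum_distrib_left[symmetric])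
  qed
  have nonneg: "0 \<le> (\<Sum>i\<in>UNIV. \<Sum>j\<in>UNIV. P i j * v i * v j) + 2 * x * (\<Sum>j\<in>UNIV. P s j * v j) + x\<^sup>2 * P s s"
    for v x using psd[of "\<lambda>i. v i + x * (if i = s then 1 else 0)"] expand[of v x] by simp
  show ?case
  proof (cases "P s s = 0")
    case True
    \<comment> \<open>Since \<open>P s s = 0\<close>, the form at e_j + x e_s is affine in x with
      slope \<open>2 * P s j\<close>; it stays nonnegative for all x only if the slope is
      zero.\<close>
    have "P s j = 0" for j
    proof (rule ccontr)
      assume n: "P s j \<noteq> 0"
      define v where "v = (\<lambda>i. of_bool (i = j) :: real)"
      have "(\<Sum>k\<in>UNIV. P s k * v k) = P s j" by (simp add: v_def of_bool_def if_distrib[where f="(*) _"] cong: if_cong)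
      moreover have "(\<Sum>i\<in>UNIV. \<Sum>k\<in>UNIV. P i k * v i * v k) = P j j"
        by (simp add: v_def mult.assoc flip: sum_distrib_left) (simp add: of_bool_def if_distrib[where f="(*) _"] cong: if_cong)
      ultimately have "0 \<le> P j j + 2 * x * P s j" for x
        using nonneg[of v x] True by simp
      from this[of "- (P j j + 1) / (2 * P s j)"] n show False by (simp add: field_simps)
    qed
    then have "P i j = 0" if "i \<notin> I" for i j
      using supp[of i j] that by (cases "i = s") auto
    then show ?thesis by (intro insert.IH sym psd)
  next
    case False
    have "P s s \<ge> 0" using nonneg[of "\<lambda>_. 0" 1] by simp
    with False have pos: "P s s > 0" by simp
    define Q where "Q = (\<lambda>i j. P i j - P s i * P s j / P s s)"
    have Qquad: "(\<Sum>i\<in>UNIV. \<Sum>j\<in>UNIV. Q i j * w i j)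
       = (\<Sum>i\<in>UNIV. \<Sum>j\<in>UNIV. P i j * w i j) - (\<Sum>i\<in>UNIV. \<Sum>j\<in>UNIV. w i j * P s i * P s j) / P s s" for w
    proof -
      have "Q i j * w i j = P i j * w i j - w i j * P s i * P s j / P s s" for i j
        by (simp add: Q_def algebra_simps)
      then show ?thesis
        by (simp add: sum_subtractf sum_divide_distrib)
    qed
    have "0 \<le> (\<Sum>i\<in>UNIV. \<Sum>j\<in>UNIV. Q i j * v i * v j)" for v
    proof -
      define b where "b = (\<Sum>j\<in>UNIV. P s j * v j)"
      have "(\<Sum>i\<in>UNIV. \<Sum>j\<in>UNIV. v i * v j * P s i * P s j) = b * b"
        unfolding b_def sum_product by (intro sum.cong refl) (simp add: mult_ac)
      \<comment> \<open>The value x = - b / \<open>P s s\<close> minimises the form of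
        \<open>P\<close> along v + x e_s, and the minimum is the form of \<open>Q\<close> at
        v.\<close>
      moreover have "0 \<le> (\<Sum>i\<in>UNIV. \<Sum>j\<in>UNIV. P i j * v i * v j) + 2 * (- b / P s s) * b + (- b / P s s)\<^sup>2 * P s s"
        unfolding b_def by (rule nonneg)
      moreover have "2 * (- b / P s s) * b + (- b / P s s)\<^sup>2 * P s s = - (b * b / P s s)"
        using pos by (simp add: power2_eq_square)
      ultimately show ?thesis
        using Qquad[of "\<lambda>i j. v i * v j"] by (simp add: mult.assoc)
    qed
    moreover have "Q i j = Q j i" for i j
      using sym[of i j] by (simp add: Q_def mult.commute)
    moreover have "Q i j = 0" if "i \<notin> I" for i j
      using supp[of i] that sym[of s i] pos by (cases "i = s") (auto simp: Q_def)
    ultimately have "0 \<le> (\<Sum>i\<in>UNIV. \<Sum>j\<in>UNIV. Q i j * H i j)"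
      by (intro insert.IH)
    then show ?thesis
      using Qquad[of H] divide_nonneg_pos[OF H[of "P s"] pos] by linarith
  qed
qed

lemma trace_psd_nonneg:
  fixes P H :: "'n::finite \<Rightarrow> 'n \<Rightarrow> real"
  assumes "\<And>i j. P i j = P j i"
    and "\<And>v. 0 \<le> (\<Sum>i\<in>UNIV. \<Sum>j\<in>UNIV. P i j * v i * v j)"
    and "\<And>v. 0 \<le> (\<Sum>i\<in>UNIV. \<Sum>j\<in>UNIV. H i j * v i * v j)"
  shows "0 \<le> (\<Sum>i\<in>UNIV. \<Sum>j\<in>UNIV. P i j * H i j)"
  by (rule trace_psd_nonneg_aux[where I = UNIV]) (use assms in auto)

section \<open>Derivatives within a set, restriction to lines, and symmetry of second
  derivatives\<close>

lemma D1_has_derivative: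
  assumes "f differentiable (at x within S)"
  shows "(f has_derivative D1 f S x) (at x within S)"
  using assms by (simp add: D1_def[abs_def] frechet_derivative_works)

lemma D2_has_derivative:
  assumes "(\<lambda>y. D1 f S y p) differentiable (at x within S)"
  shows "((\<lambda>y. D1 f S y p) has_derivative D2 f S x p) (at x within S)"
  using assms by (simp add: D2_def[abs_def] frechet_derivative_works)

text \<open>Both sets are left general so that open segments, whole lines and the closed time
  interval with its one-sided derivatives are all covered.\<close>

lemma has_derivative_along_line:
  fixes f :: "'a::real_normed_vector \<Rightarrow> real"
  assumes "(f has_derivative f') (at (a + r *\<^sub>R b) within S)"
    and "\<And>s. s \<in> I \<Longrightarrow> a + s *\<^sub>R b \<in> S"
  shows "((\<lambda>s. f (a + s *\<^sub>R b)) has_real_derivative f' b) (at r within I)"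
proof -
  have "((\<lambda>s. a + s *\<^sub>R b) has_derivative (\<lambda>h. h *\<^sub>R b)) (at r within I)"
    by (auto intro!: derivative_eq_intros)
  moreover have "(f has_derivative f') (at (a + r *\<^sub>R b) within (\<lambda>s. a + s *\<^sub>R b) ` I)"
    using assms by (blast intro: has_derivative_subset)
  ultimately have "((\<lambda>s. f (a + s *\<^sub>R b)) has_derivative (\<lambda>h. f' (h *\<^sub>R b))) (at r within I)"
    by (rule has_derivative_in_compose)
  moreover have "f' (h *\<^sub>R b) = h * f' b" for h
    using linear_scale[OF has_derivative_linear[OF assms(1)]] by simp
  ultimately show ?thesis
    by (simp add: has_field_derivative_def mult_commute_abs)
qed

text \<open>The quotient is symmetric in p and q, so its limit yields Schwarz's theorem. The mean
  value theorem along p turns the second difference into a difference of first derivatives at two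
  points near x, to which the linear approximation at x applies; continuity of second derivatives
  does not enter.\<close>

lemma second_difference_tendsto:
  fixes f :: "'a::real_normed_vector \<Rightarrow> real"
  assumes S: "open S" "x \<in> S"
    and f: "\<And>y. y \<in> S \<Longrightarrow> f differentiable (at y within S)"
    and f': "(\<lambda>y. D1 f S y p) differentiable (at x within S)"
  shows "((\<lambda>s. (f (x + s *\<^sub>R p + s *\<^sub>R q) - f (x + s *\<^sub>R p) - f (x + s *\<^sub>R q) + f x) / s\<^sup>2)
     \<longlongrightarrow> D2 f S x p q) (at_right 0)"
proof (rule tendstoI)
  fix e :: real assume e: "e > 0"
  define N where "N = norm p + norm q + 1"
  have N: "N > 0" by (simp add: N_def add_nonneg_pos)
  let ?A = "D2 f S x p"
  have A: "((\<lambda>y. D1 f S y p) has_derivative ?A) (at x)"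
    using D2_has_derivative[OF f'] at_within_open[OF S(2,1)] by simp
  then have lin: "linear ?A" by (rule has_derivative_linear)
  \<comment> \<open>The approximation is applied at two points within distance s N of x. Each costs
    e s / 4, which leaves an error e / 2 after division by s.\<close>
  obtain d0 where d0: "d0 > 0" "\<And>y. norm (y - x) < d0 \<Longrightarrow>
      norm (D1 f S y p - D1 f S x p - ?A (y - x)) \<le> e / (4 * N) * norm (y - x)"
    using A[unfolded has_derivative_at_alt] e N by (metis divide_pos_pos mult_pos_pos zero_less_numeral)
  obtain d1 where d1: "d1 > 0" "ball x d1 \<subseteq> S" using S openE by blast
  define d where "d = min d0 d1 / N"
  have d: "d > 0" using d0 d1 N by (simp add: d_def)
  have close: "norm (t *\<^sub>R p + r *\<^sub>R q) \<le> s * N" "norm (t *\<^sub>R p + r *\<^sub>R q) < d0" "x + t *\<^sub>R p + r *\<^sub>R q \<in> S"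
    if "0 \<le> t" "t \<le> s" "0 \<le> r" "r \<le> s" "s < d" "0 < s" for t r s
  proof -
    have "norm (t *\<^sub>R p + r *\<^sub>R q) \<le> t * norm p + r * norm q"
      using that by (metis norm_triangle_ineq norm_scaleR abs_of_nonneg)
    also have "\<dots> \<le> s * norm p + s * norm q"
      using that by (intro add_mono mult_right_mono) auto
    also have "\<dots> \<le> s * N" using that by (simp add: N_def algebra_simps)
    finally show *: "norm (t *\<^sub>R p + r *\<^sub>R q) \<le> s * N" .
    have "s * N < min d0 d1" using that N by (simp add: d_def field_simps)
    with * show "norm (t *\<^sub>R p + r *\<^sub>R q) < d0" by simp
    have "dist (x + (t *\<^sub>R p + r *\<^sub>R q)) x < d1"
      using * \<open>s * N < min d0 d1\<close> by (simp add: dist_norm)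
    then show "x + t *\<^sub>R p + r *\<^sub>R q \<in> S" using d1 by (auto simp: add.assoc dist_commute)
  qed
  have "\<bar>(f (x + s *\<^sub>R p + s *\<^sub>R q) - f (x + s *\<^sub>R p) - f (x + s *\<^sub>R q) + f x) / s\<^sup>2 - ?A q\<bar> < e"
    if s: "0 < s" "s < d" for s
  proof -
    let ?g = "\<lambda>t. f ((x + s *\<^sub>R q) + t *\<^sub>R p) - f (x + t *\<^sub>R p)"
    let ?g' = "\<lambda>t. D1 f S (x + s *\<^sub>R q + t *\<^sub>R p) p - D1 f S (x + t *\<^sub>R p) p"
    have "(?g has_real_derivative ?g' t) (at t)" if t: "0 \<le> t" "t \<le> s" for t
    proof -
      have m: "x + s *\<^sub>R q + t *\<^sub>R p \<in> S" "x + t *\<^sub>R p \<in> S"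
        using close(3)[of t s s] close(3)[of t s 0] s t by (auto simp: add_ac)
      then have "(f has_derivative D1 f S (x + s *\<^sub>R q + t *\<^sub>R p)) (at (x + s *\<^sub>R q + t *\<^sub>R p))"
        "(f has_derivative D1 f S (x + t *\<^sub>R p)) (at (x + t *\<^sub>R p))"
        using D1_has_derivative[OF f] at_within_open[OF _ S(1)] by metis+
      then show ?thesis
        by (intro DERIV_diff) (rule has_derivative_along_line[where S=UNIV], simp, simp)+
    qed
    then obtain t where t: "0 < t" "t < s" "?g s - ?g 0 = (s - 0) * ?g' t"
      using MVT2[of 0 s ?g ?g'] s by auto
    define y1 y2 where "y1 = x + s *\<^sub>R q + t *\<^sub>R p" and "y2 = x + t *\<^sub>R p"
    have y1: "norm (y1 - x) \<le> s * N" "norm (y1 - x) < d0"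
      using close[of t s s] s t by (auto simp: y1_def add_ac)
    have y2: "norm (y2 - x) \<le> s * N" "norm (y2 - x) < d0"
      using close[of t s 0] s t by (auto simp: y2_def add_ac)
    have b: "e / (4 * N) * r \<le> e * s / 4" if "r \<le> s * N" for r
    proof -
      have "e / (4 * N) * r \<le> e / (4 * N) * (s * N)" using that e N by (intro mult_left_mono) auto
      then show ?thesis using N by simp
    qed
    have "?A (y1 - x) - ?A (y2 - x) = ?A (s *\<^sub>R q)"
      using linear_diff[OF lin, of "y1 - x" "y2 - x"] by (simp add: y1_def y2_def)
    then have "?A (y1 - x) - ?A (y2 - x) = s * ?A q"
      using linear_scale[OF lin] by simp
    then have "\<bar>?g' t - s * ?A q\<bar> \<le> e * s / 4 + e * s / 4"
      using d0(2)[OF y1(2)] d0(2)[OF y2(2)] b[OF y1(1)] b[OF y2(1)]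
      unfolding y1_def[symmetric] y2_def[symmetric] real_norm_def by linarith
    then have "\<bar>?g' t - s * ?A q\<bar> < e * s" using mult_pos_pos[OF e s(1)] by linarith
    moreover have "f (x + s *\<^sub>R p + s *\<^sub>R q) - f (x + s *\<^sub>R p) - f (x + s *\<^sub>R q) + f x = s * ?g' t"
      using t(3) by (simp add: add_ac)
    then have "(f (x + s *\<^sub>R p + s *\<^sub>R q) - f (x + s *\<^sub>R p) - f (x + s *\<^sub>R q) + f x) / s\<^sup>2 - ?A q
        = (?g' t - s * ?A q) / s"
      using s(1) by (simp add: power2_eq_square diff_divide_distrib)
    ultimately show ?thesis using s(1) by (simp add: abs_divide pos_divide_less_eq)
  qed
  then show "\<forall>\<^sub>F s in at_right 0. dist ((f (x + s *\<^sub>R p + s *\<^sub>R q) - f (x + s *\<^sub>R p) - f (x + s *\<^sub>R q) + f x) / s\<^sup>2)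
      (D2 f S x p q) < e"
    unfolding eventually_at_right_field dist_real_def using d by auto
qed

lemma D2_symmetric:
  fixes f :: "'a::real_normed_vector \<Rightarrow> real"
  assumes "open S" "x \<in> S"
    and "\<And>y. y \<in> S \<Longrightarrow> f differentiable (at y within S)"
    and "\<And>p. (\<lambda>y. D1 f S y p) differentiable (at x within S)"
  shows "D2 f S x p q = D2 f S x q p"
proof -
  have "(\<lambda>s. (f (x + s *\<^sub>R p + s *\<^sub>R q) - f (x + s *\<^sub>R p) - f (x + s *\<^sub>R q) + f x) / s\<^sup>2)
    = (\<lambda>s. (f (x + s *\<^sub>R q + s *\<^sub>R p) - f (x + s *\<^sub>R q) - f (x + s *\<^sub>R p) + f x) / s\<^sup>2)"
    by (simp add: algebra_simps)
  then show ?thesis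
    using second_difference_tendsto[OF assms(1-3) assms(4)[of p], of q]
      second_difference_tendsto[OF assms(1-3) assms(4)[of q], of p]
    by (metis (no_types, lifting) tendsto_unique trivial_limit_at_right_real)
qed

section \<open>Ellipticity from uniform convexity\<close>

lemma standing_F_zero:
  assumes "standing_F F" shows "F 0 = 0"
proof -
  have "F (2 *\<^sub>R 0) = 2 * F 0"
    using assms unfolding standing_F_def by (meson zero_less_numeral)
  then show ?thesis by simp
qed

lemma standing_F_pos:
  assumes "standing_F F" "v \<noteq> 0" shows "F v > 0"
  using assms unfolding standing_F_def by blast

lemma standing_F_scale:
  assumes "standing_F F" "a \<ge> 0" shows "F (a *\<^sub>R v) = a * F v"
proof (cases "a = 0")
  case False
  with assms(2) have "a > 0" by simp
  then show ?thesis using assms(1) unfolding standing_F_def by blast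
qed (simp add: standing_F_zero[OF assms(1)])

lemma standing_F_triangle:
  assumes "standing_F F" shows "F (x + y) \<le> F x + F y"
proof -
  have "convex_on UNIV F" using assms by (simp add: standing_F_def)
  from convex_onD[OF this, of "1/2" x y]
  have "F ((1/2) *\<^sub>R (x + y)) \<le> F x / 2 + F y / 2" by (simp add: scaleR_add_right)
  then show ?thesis using standing_F_scale[OF assms, of "1/2" "x + y"] by simp
qed

lemma standing_F_differentiable:
  assumes "standing_F F" "v \<noteq> 0"
  shows "F differentiable (at v within - {0})" "(\<lambda>y. D1 F (- {0}) y p) differentiable (at v within - {0})"
  using assms unfolding standing_F_def C3_on_def by blast+

lemma standing_F_norm_bounds:
  fixes F :: "real \<times> (real^'n) \<Rightarrow> real"
  assumes F: "standing_F F"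
  obtains b B where "b > 0" "B > 0" "\<And>v. b * norm v \<le> F v" "\<And>v. F v \<le> B * norm v"
proof -
  let ?S = "sphere 0 1 :: (real \<times> (real^'n)) set"
  have "F differentiable (at v within ?S)" if "v \<in> ?S" for v
    by (rule differentiable_subset[OF standing_F_differentiable(1)[OF F]]) (use that in auto)
  then have cont: "continuous_on ?S F"
    by (simp add: differentiable_imp_continuous_on differentiable_on_def)
  have ne: "?S \<noteq> {}" by simp
  obtain v1 where v1: "v1 \<in> ?S" "\<And>v. v \<in> ?S \<Longrightarrow> F v1 \<le> F v"
    using continuous_attains_inf[OF compact_sphere ne cont] by blast
  obtain v2 where v2: "v2 \<in> ?S" "\<And>v. v \<in> ?S \<Longrightarrow> F v \<le> F v2"
    using continuous_attains_sup[OF compact_sphere ne cont] by blast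
  have "v1 \<noteq> 0" "v2 \<noteq> 0" using v1(1) v2(1) by auto
  then have pos: "F v1 > 0" "F v2 > 0" using standing_F_pos[OF F] by auto
  have *: "F v1 * norm v \<le> F v \<and> F v \<le> F v2 * norm v" for v
  proof (cases "v = 0")
    case False
    let ?w = "(1 / norm v) *\<^sub>R v"
    have "?w \<in> ?S" using False by simp
    moreover have "F v = norm v * F ?w"
      using standing_F_scale[OF F, of "norm v" ?w] False by simp
    ultimately show ?thesis using v1(2)[of ?w] v2(2)[of ?w] False
      by (metis mult.commute mult_left_mono norm_ge_zero)
  qed (simp add: standing_F_zero[OF F])
  show ?thesis by (rule that[OF pos]) (use * in auto)
qed

text \<open>Uniform convexity puts a ball around the midpoint m into the unit sublevel set. Moving m
  radially outwards inside that ball keeps F at most 1, and homogeneity converts the stretching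
  factor into a bound for F at m.\<close>

lemma standing_F_strict_midpoint:
  fixes F :: "real \<times> (real^'n) \<Rightarrow> real"
  assumes F: "standing_F F"
  obtains k where "k > 0"
    "\<And>x y. F x = 1 \<Longrightarrow> F y = 1 \<Longrightarrow> F ((1/2) *\<^sub>R (x + y)) \<le> 1 - k * (norm (x - y))\<^sup>2"
proof -
  obtain b B where b: "b > 0" "\<And>v. b * norm v \<le> F v" using standing_F_norm_bounds[OF F] by metis
  have "uniformly_convex_set {v. F v \<le> 1}" using F by (simp add: standing_F_def)
  then obtain c where c: "c > 0"
    "\<And>x y. F x \<le> 1 \<Longrightarrow> F y \<le> 1 \<Longrightarrow> ball ((1/2) *\<^sub>R (x + y)) (c * (norm (x - y))\<^sup>2) \<subseteq> {v. F v \<le> 1}"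
    unfolding uniformly_convex_set_def by auto
  \<comment> \<open>The first entry serves m = 0, where |x - y|^2 \<le> 4 / b^2 makes the right side
    nonnegative. The second comes from 1 - 1 / (1 + r b) = r b / (1 + r b) with r b = c b d / 2 and
    r b \<le> 2 c / b.\<close>
  define k where "k = min (b\<^sup>2 / 4) ((c * b / 2) / (1 + 2 * c / b))"
  have k: "k > 0" using b c by (simp add: k_def add_pos_pos)
  have "F ((1/2) *\<^sub>R (x + y)) \<le> 1 - k * (norm (x - y))\<^sup>2" if x: "F x = 1" and y: "F y = 1" for x y
  proof -
    define m where "m = (1/2) *\<^sub>R (x + y)"
    define d where "d = (norm (x - y))\<^sup>2"
    have nx: "norm x \<le> 1 / b" "norm y \<le> 1 / b"
      using b(2)[of x] b(2)[of y] x y b(1) by (auto simp: field_simps)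
    have nm: "norm m \<le> 1 / b" unfolding m_def
      using norm_triangle_ineq[of x y] nx by simp
    have "norm (x - y) \<le> 2 / b" using norm_triangle_ineq4[of x y] nx by simp
    then have "d \<le> (2 / b)\<^sup>2" unfolding d_def by (intro power_mono) auto
    then have d4: "d \<le> 4 / b\<^sup>2" by (simp add: power_divide)
    have d0: "d \<ge> 0" by (simp add: d_def)
    show ?thesis
    proof (cases "m = 0")
      case True
      have "k \<le> b\<^sup>2 / 4" unfolding k_def by (rule min.cobounded1)
      then have "k * d \<le> (b\<^sup>2 / 4) * (4 / b\<^sup>2)"
        using d4 d0 by (intro mult_mono) simp_all
      then show ?thesis
        using True standing_F_zero[OF F] b by (simp add: m_def[symmetric] d_def[symmetric])
    next
      case False
      \<comment> \<open>Half the radius, because the ball is open; for d = 0 the ball is empty and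
        the case x = y is treated directly.\<close>
      define r where "r = c * d / 2"
      have r0: "r \<ge> 0" using c d0 by (simp add: r_def)
      have "F ((1 + r / norm m) *\<^sub>R m) \<le> 1"
      proof (cases "d = 0")
        case True
        then have "x = y" by (simp add: d_def)
        then show ?thesis using True x by (simp add: r_def m_def flip: scaleR_2)
      next
        case 2: False
        have "dist m ((1 + r / norm m) *\<^sub>R m) = norm ((r / norm m) *\<^sub>R m)"
          by (simp add: dist_norm algebra_simps)
        also have "\<dots> = r" using False r0 by simp
        also have "r < c * d" using 2 d0 c by (simp add: r_def)
        finally show ?thesis using c(2)[of x y] x y by (auto simp: m_def[symmetric] d_def)
      qed
      then have 1: "(1 + r / norm m) * F m \<le> 1"
        using standing_F_scale[OF F, of "1 + r / norm m" m] r0 by simp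
      have Fm: "F m > 0" using standing_F_pos[OF F False] .
      have "r * b \<le> r / norm m"
        using mult_left_mono[OF nm r0] False b by (simp add: field_simps)
      then have "(1 + r * b) * F m \<le> (1 + r / norm m) * F m"
        using Fm by (intro mult_right_mono) auto
      with 1 have 2: "F m \<le> 1 / (1 + r * b)"
        using r0 b by (simp add: pos_le_divide_eq add_pos_nonneg mult.commute)
      have rb: "r * b \<le> 2 * c / b"
      proof -
        have "r * b \<le> (c * (4 / b\<^sup>2) / 2) * b"
          unfolding r_def using d4 c b by (intro mult_right_mono divide_right_mono mult_left_mono) auto
        then show ?thesis using b by (simp add: power2_eq_square)
      qed
      have "k * d \<le> ((c * b / 2) / (1 + 2 * c / b)) * d"
        using d0 by (intro mult_right_mono) (auto simp: k_def)
      also have "\<dots> = r * b / (1 + 2 * c / b)" by (simp add: r_def)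
      also have "\<dots> \<le> r * b / (1 + r * b)"
        using rb r0 b c by (intro divide_left_mono) (auto intro!: mult_pos_pos add_pos_nonneg)
      also have "\<dots> = 1 - 1 / (1 + r * b)"
        using mult_nonneg_nonneg[OF r0, of b] b by (simp add: field_simps)
      finally show ?thesis using 2 by (simp add: m_def[symmetric] d_def[symmetric])
    qed
  qed
  with k show ?thesis using that by blast
qed

text \<open>With F y \<le> F x and X, Y the vectors rescaled to the unit level, x + y is 2 F y times
  the midpoint of X and Y plus the surplus (F x - F y) X. The midpoint deficit is therefore gained
  with the weight of the smaller vector.\<close>

lemma standing_F_strict_triangle:
  fixes F :: "real \<times> (real^'n) \<Rightarrow> real"
  assumes F: "standing_F F"
  obtains k where "k > 0"
    "\<And>x y. x \<noteq> 0 \<Longrightarrow> y \<noteq> 0 \<Longrightarrow> F (x + y) \<le> F x + F y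
        - k * min (F x) (F y) * (norm ((1 / F x) *\<^sub>R x - (1 / F y) *\<^sub>R y))\<^sup>2"
proof -
  obtain k where k: "k > 0"
    "\<And>x y. F x = 1 \<Longrightarrow> F y = 1 \<Longrightarrow> F ((1/2) *\<^sub>R (x + y)) \<le> 1 - k * (norm (x - y))\<^sup>2"
    using standing_F_strict_midpoint[OF F] by metis
  have *: "F (x + y) \<le> F x + F y
        - (2 * k) * F y * (norm ((1 / F x) *\<^sub>R x - (1 / F y) *\<^sub>R y))\<^sup>2"
    if "x \<noteq> 0" "y \<noteq> 0" "F y \<le> F x" for x y
  proof -
    define X Y where "X = (1 / F x) *\<^sub>R x" and "Y = (1 / F y) *\<^sub>R y"
    have pos: "F x > 0" "F y > 0" using that standing_F_pos[OF F] by auto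
    have X: "F X = 1" "F x *\<^sub>R X = x" and Y: "F Y = 1" "F y *\<^sub>R Y = y"
      using pos by (auto simp: X_def Y_def standing_F_scale[OF F])
    have "(2 * F y) *\<^sub>R ((1/2) *\<^sub>R (X + Y)) + (F x - F y) *\<^sub>R X = F x *\<^sub>R X + F y *\<^sub>R Y"
      by (simp add: algebra_simps)
    then have "x + y = (2 * F y) *\<^sub>R ((1/2) *\<^sub>R (X + Y)) + (F x - F y) *\<^sub>R X"
      using X Y by simp
    then have "F (x + y) \<le> F ((2 * F y) *\<^sub>R ((1/2) *\<^sub>R (X + Y))) + F ((F x - F y) *\<^sub>R X)"
      using standing_F_triangle[OF F] by metis
    also have "\<dots> = 2 * F y * F ((1/2) *\<^sub>R (X + Y)) + (F x - F y)"
      using standing_F_scale[OF F, of "2 * F y" "(1/2) *\<^sub>R (X + Y)"]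
        standing_F_scale[OF F, of "F x - F y" X] pos that X by simp
    also have "\<dots> \<le> 2 * F y * (1 - k * (norm (X - Y))\<^sup>2) + (F x - F y)"
      using k(2)[OF X(1) Y(1)] pos by (intro add_right_mono mult_left_mono) auto
    finally show ?thesis by (simp add: X_def Y_def algebra_simps)
  qed
  show ?thesis
  proof (rule that[of "2 * k"])
    fix x y :: "real \<times> (real^'n)" assume "x \<noteq> 0" "y \<noteq> 0"
    then show "F (x + y) \<le> F x + F y
        - 2 * k * min (F x) (F y) * (norm ((1 / F x) *\<^sub>R x - (1 / F y) *\<^sub>R y))\<^sup>2"
      using *[of x y] *[of y x] by (cases "F y \<le> F x") (auto simp: min_def add_ac norm_minus_commute)
  qed (use k in simp)
qed

text \<open>The left side is the squared norm of the component of g w orthogonal to v, which adding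
  multiples of v does not change.\<close>

lemma norm_lincomb_ge:
  fixes v w :: "'a::real_inner"
  assumes "v \<noteq> 0"
  shows "g\<^sup>2 * ((norm w)\<^sup>2 - (w \<bullet> v)\<^sup>2 / (norm v)\<^sup>2) \<le> (norm (a *\<^sub>R v + g *\<^sub>R w))\<^sup>2"
proof -
  have n: "norm v > 0" using assms by simp
  have "(norm (a *\<^sub>R v + g *\<^sub>R w))\<^sup>2 = a\<^sup>2 * (norm v)\<^sup>2 + 2 * a * g * (w \<bullet> v) + g\<^sup>2 * (norm w)\<^sup>2"
    by (simp only: power2_norm_eq_inner)
      (simp add: inner_add_left inner_add_right inner_commute power2_eq_square algebra_simps)
  moreover have "0 \<le> (a * norm v + g * (w \<bullet> v) / norm v)\<^sup>2" by simp
  then have "0 \<le> a\<^sup>2 * (norm v)\<^sup>2 + 2 * a * g * (w \<bullet> v) + g\<^sup>2 * ((w \<bullet> v)\<^sup>2 / (norm v)\<^sup>2)"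
    using n by (simp add: power2_sum power_mult_distrib power_divide)
  ultimately show ?thesis by (simp add: algebra_simps)
qed

text \<open>Only the part of w orthogonal to v can be controlled, as F is linear along the ray of v.
  The strict triangle inequality for v + s w and v - s w shows that their F-sum minus a multiple of
  s^2 is minimal at s = 0, and the second derivative test finishes. The factor \<open>F v\<close>
  makes the right side invariant under scaling of v.\<close>

lemma standing_F_elliptic:
  fixes F :: "real \<times> (real^'n) \<Rightarrow> real"
  assumes F: "standing_F F"
  obtains c where "c > 0"
    "\<And>v w. v \<noteq> 0 \<Longrightarrow> c * ((norm w)\<^sup>2 - (w \<bullet> v)\<^sup>2 / (norm v)\<^sup>2) \<le> F v * D2 F (- {0}) v w w"
proof -
  obtain k where k: "k > 0"
    "\<And>x y. x \<noteq> 0 \<Longrightarrow> y \<noteq> 0 \<Longrightarrow> F (x + y) \<le> F x + F y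
        - k * min (F x) (F y) * (norm ((1 / F x) *\<^sub>R x - (1 / F y) *\<^sub>R y))\<^sup>2"
    using standing_F_strict_triangle[OF F] by metis
  obtain b B where B: "B > 0" "\<And>v. F v \<le> B * norm v" using standing_F_norm_bounds[OF F] by metis
  have "k / 2 * ((norm w)\<^sup>2 - (w \<bullet> v)\<^sup>2 / (norm v)\<^sup>2) \<le> F v * D2 F (- {0}) v w w"
    if v: "v \<noteq> 0" for v w
  proof -
    define m where "m = (norm w)\<^sup>2 - (w \<bullet> v)\<^sup>2 / (norm v)\<^sup>2"
    \<comment> \<open>The product of k, the lower bound F v / 2 for both values of F, and the lower
      bound s^2 m / (F v)^2 for the squared distance of the normalised vectors equals th
      s^2.\<close>
    define th where "th = k * m / (2 * F v)"
    have Fv: "F v > 0" using standing_F_pos[OF F v] .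
    \<comment> \<open>For |s| < d the perturbation s w changes F by at most F v / 2; the summand 1
      allows w = 0.\<close>
    define d where "d = F v / (2 * B * (norm w + 1))"
    have d: "d > 0" using Fv B by (simp add: d_def add_nonneg_pos)
    have near: "F v / 2 \<le> F (v + s *\<^sub>R w)" "F (v + s *\<^sub>R w) \<le> 2 * F v" if "\<bar>s\<bar> < d" for s
    proof -
      have "\<bar>s\<bar> * norm w \<le> d * (norm w + 1)" using that by (intro mult_mono) auto
      then have "B * (\<bar>s\<bar> * norm w) \<le> B * (d * (norm w + 1))" using B by simp
      also have "\<dots> = F v / 2"
        using B add_nonneg_pos[of "norm w" 1] by (simp add: d_def)
      finally have *: "B * norm (r *\<^sub>R w) \<le> F v / 2" if "\<bar>r\<bar> = \<bar>s\<bar>" for r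
        using that by simp
      show "F (v + s *\<^sub>R w) \<le> 2 * F v"
        using standing_F_triangle[OF F, of v "s *\<^sub>R w"] B(2)[of "s *\<^sub>R w"] *[of s] Fv by linarith
      show "F v / 2 \<le> F (v + s *\<^sub>R w)"
        using standing_F_triangle[OF F, of "v + s *\<^sub>R w" "(- s) *\<^sub>R w"] B(2)[of "(- s) *\<^sub>R w"] *[of "- s"] by simp
    qed
    have nz: "v + s *\<^sub>R w \<noteq> 0" if "\<bar>s\<bar> < d" for s
      using near(1)[OF that] Fv standing_F_zero[OF F] by auto
    define h where "h = (\<lambda>s. F (v + s *\<^sub>R w) + F (v + s *\<^sub>R (- w)) - th * s\<^sup>2)"
    define h' where "h' = (\<lambda>s. D1 F (- {0}) (v + s *\<^sub>R w) w + D1 F (- {0}) (v + s *\<^sub>R (- w)) (- w) - 2 * th * s)"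
    have lin: "linear (D2 F (- {0}) v p)" for p
      using D2_has_derivative[OF standing_F_differentiable(2)[OF F v]] has_derivative_linear by blast
    have wI: "at s within {-d<..<d} = at s" if "\<bar>s\<bar> < d" for s
      by (rule at_within_open) (use that in auto)
    have dF: "((\<lambda>s. F (v + s *\<^sub>R u)) has_real_derivative D1 F (- {0}) (v + s *\<^sub>R u) u) (at s)"
      if "\<bar>s\<bar> < d" "u = w \<or> u = - w" for s u
    proof -
      have nz': "v + r *\<^sub>R u \<in> - {0}" if "r \<in> {-d<..<d}" for r
        using nz[of r] nz[of "- r"] \<open>u = w \<or> u = - w\<close> that by (auto simp: abs_less_iff)
      have "v + s *\<^sub>R u \<noteq> 0" using nz'[of s] that by (auto simp: abs_less_iff)
      from has_derivative_along_line[OF D1_has_derivative[OF standing_F_differentiable(1)[OF F this]], of "{-d<..<d}"]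
      show ?thesis using nz' wI[OF that(1)] by simp
    qed
    have d2F: "((\<lambda>s. D1 F (- {0}) (v + s *\<^sub>R u) u) has_real_derivative D2 F (- {0}) v w w) (at 0)"
      if "u = w \<or> u = - w" for u
    proof -
      have nz': "v + r *\<^sub>R u \<in> - {0}" if "r \<in> {-d<..<d}" for r
        using nz[of r] nz[of "- r"] \<open>u = w \<or> u = - w\<close> that by (auto simp: abs_less_iff)
      have "((\<lambda>y. D1 F (- {0}) y u) has_derivative D2 F (- {0}) v u) (at (v + 0 *\<^sub>R u) within - {0})"
        using D2_has_derivative[OF standing_F_differentiable(2)[OF F v]] by simp
      from has_derivative_along_line[OF this, of "{-d<..<d}"]
      have 1: "((\<lambda>s. D1 F (- {0}) (v + s *\<^sub>R u) u) has_real_derivative D2 F (- {0}) v u u) (at 0)"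
        using nz' wI[of 0] d by simp
      \<comment> \<open>Linearity is at hand only in the last argument of \<open>D2\<close>;
        symmetry carries the sign out of the other one.\<close>
      have sym: "D2 F (- {0}) v w (-w) = D2 F (- {0}) v (- w) w"
        by (rule D2_symmetric) (use v standing_F_differentiable[OF F] in auto)
      have "D2 F (- {0}) v u u = D2 F (- {0}) v w w"
        using \<open>u = w \<or> u = - w\<close> linear_neg[OF lin[of "- w"], of w] linear_neg[OF lin[of w], of w] sym by auto
      with 1 show ?thesis by simp
    qed
    have "0 \<le> 2 * D2 F (- {0}) v w w - 2 * th"
    proof (rule second_derivative_test_min(2)[OF d, of h h'])
      show "(h has_real_derivative h' s) (at s)" if "\<bar>s\<bar> < d" for s
        unfolding h_def h'_def
        by (rule derivative_eq_intros dF[OF that] refl | simp)+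
      show "(h' has_real_derivative 2 * D2 F (- {0}) v w w - 2 * th) (at 0)"
        unfolding h'_def
        by (rule derivative_eq_intros d2F refl | simp)+
      show "h 0 \<le> h s" if s: "\<bar>s\<bar> < d" for s
      proof -
        define x y where "x = v + s *\<^sub>R w" and "y = v + s *\<^sub>R (- w)"
        have x: "x \<noteq> 0" "F v / 2 \<le> F x" "F x \<le> 2 * F v" and y: "y \<noteq> 0" "F v / 2 \<le> F y" "F y \<le> 2 * F v"
          using nz[of s] nz[of "- s"] near[of s] near[of "- s"] s by (auto simp: x_def y_def)
        \<comment> \<open>The normalised difference is (1/F x - 1/F y) v + (1/F x + 1/F y) s w. Its
          first term is radial, so only a lower bound for the coefficient of w matters.\<close>
        have "1 / (2 * F v) \<le> 1 / F x" "1 / (2 * F v) \<le> 1 / F y"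
          using x y Fv by (auto intro!: divide_left_mono mult_pos_pos)
        then have "1 / F v \<le> 1 / F x + 1 / F y" by (simp add: field_simps)
        then have "(1 / F v)\<^sup>2 \<le> (1 / F x + 1 / F y)\<^sup>2" using Fv by (intro power_mono) auto
        then have "(1 / F v)\<^sup>2 * s\<^sup>2 \<le> (1 / F x + 1 / F y)\<^sup>2 * s\<^sup>2" by (rule mult_right_mono) simp
        moreover have m0: "m \<ge> 0"
        proof -
          have "(w \<bullet> v)\<^sup>2 \<le> (norm w)\<^sup>2 * (norm v)\<^sup>2"
            using Cauchy_Schwarz_ineq[of w v] by (simp add: power2_norm_eq_inner)
          then show ?thesis using v by (simp add: m_def pos_divide_le_eq)
        qed
        ultimately have "(1 / F v)\<^sup>2 * s\<^sup>2 * m \<le> ((1 / F x + 1 / F y) * s)\<^sup>2 * m"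
          by (simp add: power_mult_distrib mult_right_mono)
        also have "\<dots> \<le> (norm ((1 / F x - 1 / F y) *\<^sub>R v + ((1 / F x + 1 / F y) * s) *\<^sub>R w))\<^sup>2"
          unfolding m_def by (rule norm_lincomb_ge[OF v])
        also have "(1 / F x - 1 / F y) *\<^sub>R v + ((1 / F x + 1 / F y) * s) *\<^sub>R w = (1 / F x) *\<^sub>R x - (1 / F y) *\<^sub>R y"
          by (simp add: x_def y_def algebra_simps)
        finally have 1: "(1 / F v)\<^sup>2 * s\<^sup>2 * m \<le> (norm ((1 / F x) *\<^sub>R x - (1 / F y) *\<^sub>R y))\<^sup>2" .
        have "th * s\<^sup>2 = k * (F v / 2) * ((1 / F v)\<^sup>2 * s\<^sup>2 * m)"
          using Fv by (simp add: th_def power2_eq_square)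
        also have "\<dots> \<le> k * min (F x) (F y) * (norm ((1 / F x) *\<^sub>R x - (1 / F y) *\<^sub>R y))\<^sup>2"
          using 1 k x y Fv m0 by (intro mult_mono) auto
        also have "\<dots> \<le> F x + F y - F (x + y)" using k(2)[OF x(1) y(1)] by simp
        also have "x + y = 2 *\<^sub>R v" by (simp add: x_def y_def flip: scaleR_2)
        also have "F (2 *\<^sub>R v) = 2 * F v" by (rule standing_F_scale[OF F]) simp
        finally show ?thesis by (simp add: h_def x_def y_def)
      qed
    qed
    then have "F v * th \<le> F v * D2 F (- {0}) v w w" using Fv by simp
    then show ?thesis using Fv by (simp add: th_def m_def[symmetric])
  qed
  then show ?thesis using that[of "k / 2"] k by simp
qed

section \<open>The barrier\<close>

text \<open>This is the overview's G with rate K, later set to 1 / c. The centre 2M lies beyond the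
  range [-M, M] of half height differences, where the Gaussian is increasing; the subtracted
  constant gives the value 0 at z = 0, that is, on the diagonal x = y.\<close>

definition barrier :: "real \<Rightarrow> real \<Rightarrow> real \<Rightarrow> real \<Rightarrow> real" where
  "barrier K M z t = exp (- K * (2 * M - z)\<^sup>2 / t) - exp (- K * (2 * M)\<^sup>2 / t)"

definition barrier_z :: "real \<Rightarrow> real \<Rightarrow> real \<Rightarrow> real \<Rightarrow> real" where
  "barrier_z K M z t = 2 * K * (2 * M - z) / t * exp (- K * (2 * M - z)\<^sup>2 / t)"

definition barrier_zz :: "real \<Rightarrow> real \<Rightarrow> real \<Rightarrow> real \<Rightarrow> real" where
  "barrier_zz K M z t = ((2 * K * (2 * M - z) / t)\<^sup>2 - 2 * K / t) * exp (- K * (2 * M - z)\<^sup>2 / t)"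

definition barrier_t :: "real \<Rightarrow> real \<Rightarrow> real \<Rightarrow> real \<Rightarrow> real" where
  "barrier_t K M z t = K * (2 * M - z)\<^sup>2 / t\<^sup>2 * exp (- K * (2 * M - z)\<^sup>2 / t)
    - K * (2 * M)\<^sup>2 / t\<^sup>2 * exp (- K * (2 * M)\<^sup>2 / t)"

lemma barrier_has_derivative_z:
  assumes "(z has_real_derivative z') (at s within I)" "t > 0"
  shows "((\<lambda>s. barrier K M (z s) t) has_real_derivative barrier_z K M (z s) t * z') (at s within I)"
  unfolding barrier_def barrier_z_def
  by (rule derivative_eq_intros assms refl | use assms in \<open>simp add: field_simps\<close>)+

lemma barrier_z_has_derivative_z:
  assumes "(z has_real_derivative z') (at s within I)" "t > 0"
  shows "((\<lambda>s. barrier_z K M (z s) t) has_real_derivative barrier_zz K M (z s) t * z') (at s within I)"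
  unfolding barrier_z_def barrier_zz_def
  by (rule derivative_eq_intros assms refl | use assms in \<open>simp add: field_simps power2_eq_square\<close>)+

lemma barrier_has_derivative_t:
  assumes "(z has_real_derivative z') (at t within I)" "t > 0"
  shows "((\<lambda>s. barrier K M (z s) s) has_real_derivative
    barrier_z K M (z t) t * z' + barrier_t K M (z t) t) (at t within I)"
  unfolding barrier_z_def barrier_t_def barrier_def
  by (rule derivative_eq_intros assms refl | use assms in \<open>simp add: field_simps power2_eq_square\<close>)+

lemma barrier_strict_mono:
  assumes "z < w" "w \<le> M" "K > 0" "M > 0" "t > 0"
  shows "barrier K M z t < barrier K M w t"
proof -
  have "(2 * M - w)\<^sup>2 < (2 * M - z)\<^sup>2" using assms by (intro power_strict_mono) auto
  then have "K * (2 * M - w)\<^sup>2 / t < K * (2 * M - z)\<^sup>2 / t"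
    using assms by (intro divide_strict_right_mono mult_strict_left_mono) auto
  then show ?thesis by (simp add: barrier_def)
qed

text \<open>The upper bound 1 later keeps 1 + G_z^2 below 2. With X = K y^2 / t and y = 2M - z \<ge>
  M, the estimate exp X \<ge> X^2 / 2 beats the prefactor 2 K y / t exactly when 4 t \<le> K
  y^3.\<close>

lemma barrier_z_bounds:
  assumes "\<bar>z\<bar> \<le> M" "K > 0" "M > 0" "t > 0" "4 * t \<le> K * M ^ 3"
  shows "0 < barrier_z K M z t" "barrier_z K M z t \<le> 1"
proof -
  define y where "y = 2 * M - z"
  have y: "M \<le> y" "y > 0" using assms by (auto simp: y_def)
  show "0 < barrier_z K M z t" using assms y by (simp add: barrier_z_def y_def[symmetric])
  define X where "X = K * y\<^sup>2 / t"
  have X: "X > 0" using assms y by (simp add: X_def)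
  have "X\<^sup>2 / 2 \<le> exp X" using exp_lower_Taylor_quadratic[of X] X by simp
  moreover have "2 * K * y / t \<le> X\<^sup>2 / 2"
  proof -
    have "4 * t \<le> K * y ^ 3"
      using assms y power_mono[of M y 3] mult_left_mono[of "M^3" "y^3" K] by linarith
    then have "(2 * K * y / t\<^sup>2 / 2) * (4 * t) \<le> (2 * K * y / t\<^sup>2 / 2) * (K * y ^ 3)"
      using assms y by (intro mult_left_mono) auto
    then have "2 * (2 * K * y / t) \<le> X\<^sup>2"
      using assms by (simp add: X_def power2_eq_square power3_eq_cube divide_simps mult_ac)
    then show ?thesis by simp
  qed
  ultimately have "2 * K * y / t \<le> exp X" by linarith
  then have "2 * K * y / t * exp (- X) \<le> exp X * exp (- X)" by (intro mult_right_mono) auto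
  then show "barrier_z K M z t \<le> 1"
    by (simp add: barrier_z_def y_def[symmetric] X_def exp_minus_inverse mult_exp_exp)
qed

text \<open>For K = 1 / c the factor 1 / (2 K) is c / 2. Up to E / t^2 the comparison is K y^2 \<le>
  2 K y^2 - t, which small t permits. Strictness comes from the subtracted constant, whose time
  derivative lowers \<open>barrier_t\<close>.\<close>

lemma barrier_subsolution:
  assumes "\<bar>z\<bar> \<le> M" "K > 0" "M > 0" "t > 0" "t \<le> K * M\<^sup>2"
  shows "0 \<le> barrier_zz K M z t" "barrier_t K M z t < barrier_zz K M z t / (2 * K)"
proof -
  define y E where "y = 2 * M - z" and "E = exp (- K * y\<^sup>2 / t)"
  have y: "M \<le> y" using assms by (auto simp: y_def)
  have E: "E > 0" by (simp add: E_def)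
  have ty: "t \<le> K * y\<^sup>2"
    using assms y power_mono[of M y 2] mult_left_mono[of "M\<^sup>2" "y\<^sup>2" K] by linarith
  have eq: "barrier_zz K M z t = 2 * K * ((2 * K * y\<^sup>2 - t) / t\<^sup>2 * E)"
  proof -
    have "barrier_zz K M z t = ((2 * K * y / t)\<^sup>2 - 2 * K / t) * E"
      by (simp add: barrier_zz_def y_def E_def)
    also have "(2 * K * y / t)\<^sup>2 - 2 * K / t = 2 * K * ((2 * K * y\<^sup>2 - t) / t\<^sup>2)"
      using assms by (simp add: field_simps power2_eq_square)
    finally show ?thesis by simp
  qed
  have "0 \<le> 2 * K * y\<^sup>2 - t" using ty assms by linarith
  then show "0 \<le> barrier_zz K M z t" unfolding eq using E assms by simp
  have "barrier_t K M z t < K * y\<^sup>2 / t\<^sup>2 * E"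
    using assms by (simp add: barrier_t_def y_def E_def)
  also have "\<dots> \<le> (2 * K * y\<^sup>2 - t) / t\<^sup>2 * E"
    using ty E by (intro mult_right_mono divide_right_mono) auto
  also have "\<dots> = barrier_zz K M z t / (2 * K)" using assms by (simp add: eq)
  finally show "barrier_t K M z t < barrier_zz K M z t / (2 * K)" .
qed

text \<open>The first bound makes the barrier vanish uniformly as t tends to 0, which replaces
  initial data; the second confines violations of the two-point inequality to pairs at distance at
  most 2.\<close>

lemma barrier_le:
  assumes "\<bar>z\<bar> \<le> M" "K > 0" "M > 0" "t > 0"
  shows "barrier K M z t \<le> t / (K * M\<^sup>2)" "barrier K M z t \<le> 1"
proof -
  define X where "X = K * M\<^sup>2 / t"
  have X: "X > 0" using assms by (simp add: X_def)
  have "M\<^sup>2 \<le> (2 * M - z)\<^sup>2" using assms by (intro power_mono) auto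
  then have "X \<le> K * (2 * M - z)\<^sup>2 / t"
    unfolding X_def using assms by (intro divide_right_mono mult_left_mono) auto
  then have "exp (- K * (2 * M - z)\<^sup>2 / t) \<le> exp (- X)" by simp
  then have *: "barrier K M z t \<le> exp (- X)" by (simp add: barrier_def add_increasing2 diff_le_eq)
  also have "\<dots> \<le> 1" using X by simp
  finally show "barrier K M z t \<le> 1" .
  have "X \<le> exp X" using exp_ge_add_one_self[of X] by linarith
  then have "exp (- X) \<le> 1 / X" using X by (simp add: exp_minus field_simps)
  with * show "barrier K M z t \<le> t / (K * M\<^sup>2)" using assms by (simp add: X_def)
qed

section \<open>The two-point maximum principle\<close>

text \<open>Subtracting integer parts of the coordinates in a lattice basis moves every point into
  one ball; this supplies the compactness for the maximum principle.\<close>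

lemma is_lattice_cobounded:
  fixes L :: "(real^'n) set"
  assumes "is_lattice L"
  obtains R where "\<And>x. \<exists>l\<in>L. norm (x + l) \<le> R"
proof -
  obtain B :: "real^'n^'n" where B: "invertible B" "L = {B *v k | k. \<forall>i. k $ i \<in> \<int>}"
    using assms unfolding is_lattice_def by blast
  have bl: "bounded_linear ((*v) B)" by (rule matrix_vector_mul_bounded_linear)
  obtain N where N: "\<And>v. norm (B *v v) \<le> norm v * N" "N > 0"
    using bounded_linear.pos_bounded[OF bl] by auto
  have "\<exists>l\<in>L. norm (x + l) \<le> real CARD('n) * N" for x
  proof -
    obtain y where y: "x = B *v y"
      using B(1) unfolding invertible_def by (metis matrix_vector_mul_assoc matrix_vector_mul_lid)
    define k :: "real^'n" where "k = (\<chi> i. - of_int \<lfloor>y $ i\<rfloor>)"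
    have "B *v k \<in> L" unfolding B(2) by (auto simp: k_def)
    moreover have "x + B *v k = B *v (y + k)" by (simp add: y matrix_vector_right_distrib)
    moreover have "norm (y + k) \<le> real CARD('n)"
    proof -
      have "norm (y + k) \<le> (\<Sum>i\<in>UNIV. \<bar>(y + k) $ i\<bar>)" by (rule norm_le_l1_cart)
      also have "\<dots> \<le> (\<Sum>i\<in>(UNIV :: 'n set). 1)"
        by (intro sum_mono) (simp add: k_def, linarith)
      finally show ?thesis by simp
    qed
    then have "norm (y + k) * N \<le> real CARD('n) * N" using N(2) by (intro mult_right_mono) auto
    ultimately show ?thesis using N(1)[of "y + k"] by (metis order_trans)
  qed
  then show ?thesis using that by blast
qed

section \<open>Space and time derivatives of a solution on the closed time slab\<close>

definition spatial_grad :: "((real^'n) \<times> real \<Rightarrow> real) \<Rightarrow> real \<Rightarrow> real^'n \<Rightarrow> real \<Rightarrow> real^'n" where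
  "spatial_grad u T x t = (\<chi> i. D1 u (UNIV \<times> {0..T}) (x, t) (axis i 1, 0))"

definition spatial_hess :: "((real^'n) \<times> real \<Rightarrow> real) \<Rightarrow> real \<Rightarrow> real^'n \<Rightarrow> real \<Rightarrow> 'n \<Rightarrow> 'n \<Rightarrow> real" where
  "spatial_hess u T x t i j = D2 u (UNIV \<times> {0..T}) (x, t) (axis i 1, 0) (axis j 1, 0)"

lemma linear_axis_expansion:
  fixes f :: "(real^'n) \<times> real \<Rightarrow> real"
  assumes "linear f"
  shows "f (v, 0) = (\<Sum>i\<in>UNIV. f (axis i 1, 0) * v $ i)"
proof -
  have "(v, 0) = (\<Sum>i\<in>UNIV. v $ i *\<^sub>R (axis i 1, 0::real))"
    by (simp add: prod_eq_iff fst_sum snd_sum basis_expansion scalar_mult_eq_scaleR[symmetric])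
  then have "f (v, 0) = f (\<Sum>i\<in>UNIV. v $ i *\<^sub>R (axis i 1, 0::real))" by simp
  also have "\<dots> = (\<Sum>i\<in>UNIV. v $ i * f (axis i 1, 0))"
    by (simp only: linear_sum[OF assms] linear_scale[OF assms] real_scaleR_def)
  finally show ?thesis by (simp add: mult.commute)
qed

text \<open>What the two-point argument needs from the flow. The form |v|^2 - (v . p)^2 / (1 +
  |p|^2) is the inverse metric of a graph with slope p, so the coefficients dominate c times those
  of mean curvature flow.\<close>

locale quasilinear_solution =
  fixes u :: "(real^'n) \<times> real \<Rightarrow> real" and T c M :: real and a :: "real^'n \<Rightarrow> 'n \<Rightarrow> 'n \<Rightarrow> real"
  assumes c: "c > 0" and M: "M > 0"
    and diff1: "\<And>x t. 0 \<le> t \<Longrightarrow> t \<le> T \<Longrightarrow> u differentiable (at (x, t) within UNIV \<times> {0..T})"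
    and diff2: "\<And>x t v. 0 \<le> t \<Longrightarrow> t \<le> T \<Longrightarrow>
      (\<lambda>y. D1 u (UNIV \<times> {0..T}) y v) differentiable (at (x, t) within UNIV \<times> {0..T})"
    and a_sym: "\<And>p i j. a p i j = a p j i"
    and a_elliptic: "\<And>p v. c * ((norm v)\<^sup>2 - (v \<bullet> p)\<^sup>2 / (1 + (norm p)\<^sup>2))
      \<le> (\<Sum>i\<in>UNIV. \<Sum>j\<in>UNIV. a p i j * v $ i * v $ j)"
    and equation: "\<And>x t. 0 \<le> t \<Longrightarrow> t \<le> T \<Longrightarrow> D1 u (UNIV \<times> {0..T}) (x, t) (0, 1)
      = (\<Sum>i\<in>UNIV. \<Sum>j\<in>UNIV. a (spatial_grad u T x t) i j * spatial_hess u T x t i j)"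
    and bound: "\<And>x t. 0 \<le> t \<Longrightarrow> t \<le> T \<Longrightarrow> \<bar>u (x, t)\<bar> \<le> M"
begin

lemma D1_spatial:
  assumes "0 \<le> t" "t \<le> T"
  shows "D1 u (UNIV \<times> {0..T}) (x, t) (v, 0) = spatial_grad u T x t \<bullet> v"
proof -
  have lin: "linear (D1 u (UNIV \<times> {0..T}) (x, t))"
    using D1_has_derivative[OF diff1[OF assms]] has_derivative_linear by blast
  then show ?thesis
    by (simp only: linear_axis_expansion[of _ v] spatial_grad_def inner_vec_def vec_lambda_beta inner_real_def)
qed

lemma D2_spatial:
  assumes "0 \<le> t" "t \<le> T"
  shows "D2 u (UNIV \<times> {0..T}) (x, t) p (v, 0) = (\<Sum>j\<in>UNIV. D2 u (UNIV \<times> {0..T}) (x, t) p (axis j 1, 0) * v $ j)"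
proof -
  have lin: "linear (D2 u (UNIV \<times> {0..T}) (x, t) p)"
    using D2_has_derivative[OF diff2[OF assms]] has_derivative_linear by blast
  then show ?thesis by (rule linear_axis_expansion)
qed

lemma has_derivative_space:
  assumes "0 \<le> t" "t \<le> T"
  shows "((\<lambda>s. u (x + s *\<^sub>R v, t)) has_real_derivative spatial_grad u T (x + r *\<^sub>R v) t \<bullet> v) (at r)"
proof -
  have "(u has_derivative D1 u (UNIV \<times> {0..T}) (x + r *\<^sub>R v, t)) (at ((x, t) + r *\<^sub>R (v, 0)) within UNIV \<times> {0..T})"
    using D1_has_derivative[OF diff1[OF assms]] by simp
  from has_derivative_along_line[OF this, of UNIV] show ?thesis
    using assms by (simp add: D1_spatial)
qed

lemma has_derivative_space2:
  assumes "0 \<le> t" "t \<le> T"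
  shows "((\<lambda>s. spatial_grad u T (x + s *\<^sub>R v) t \<bullet> v) has_real_derivative
    (\<Sum>i\<in>UNIV. \<Sum>j\<in>UNIV. spatial_hess u T x t i j * v $ i * v $ j)) (at 0)"
proof -
  have "((\<lambda>s. D1 u (UNIV \<times> {0..T}) (x + s *\<^sub>R v, t) (axis i 1, 0)) has_real_derivative
      (\<Sum>j\<in>UNIV. spatial_hess u T x t i j * v $ j)) (at 0)" for i
  proof -
    have "((\<lambda>y. D1 u (UNIV \<times> {0..T}) y (axis i 1, 0)) has_derivative D2 u (UNIV \<times> {0..T}) (x, t) (axis i 1, 0))
       (at ((x, t) + 0 *\<^sub>R (v, 0)) within UNIV \<times> {0..T})"
      using D2_has_derivative[OF diff2[OF assms]] by simp
    from has_derivative_along_line[OF this, of UNIV] show ?thesis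
      using assms by (simp add: D2_spatial spatial_hess_def)
  qed
  then have "((\<lambda>s. \<Sum>i\<in>UNIV. D1 u (UNIV \<times> {0..T}) (x + s *\<^sub>R v, t) (axis i 1, 0) * v $ i) has_real_derivative
      (\<Sum>i\<in>UNIV. (\<Sum>j\<in>UNIV. spatial_hess u T x t i j * v $ j) * v $ i)) (at 0)"
    by (intro DERIV_sum DERIV_cmult_right)
  then show ?thesis
    by (simp add: spatial_grad_def inner_vec_def sum_distrib_right sum_distrib_left mult_ac)
qed

lemma has_derivative_time:
  assumes "0 \<le> t" "t \<le> T"
  shows "((\<lambda>s. u (x, s)) has_real_derivative D1 u (UNIV \<times> {0..T}) (x, t) (0, 1)) (at t within {0..T})"
proof -
  have "(u has_derivative D1 u (UNIV \<times> {0..T}) (x, t)) (at ((x, 0) + t *\<^sub>R (0, 1)) within UNIV \<times> {0..T})"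
    using D1_has_derivative[OF diff1[OF assms]] by simp
  from has_derivative_along_line[OF this, of "{0..T}"] show ?thesis by simp
qed

lemma continuous_u: "continuous_on (UNIV \<times> {0..T}) u"
  using diff1 by (auto intro!: differentiable_imp_continuous_on simp: differentiable_on_def)

text \<open>At a first touching point the gradients at x and y coincide, so both points see the same coefficient
  matrix. Moving x and y in parallel does not change their distance, moving them apart changes it linearly;
  splitting the coefficient matrix into a multiple of the projection onto the direction x - y and a positive
  semidefinite rest therefore reduces the second order condition to one dimension.\<close>

lemma no_touching:
  assumes t: "0 < t" "t \<le> T" "4 * t \<le> M ^ 3 / c" "t \<le> M\<^sup>2 / c" and "x \<noteq> y"
    and space: "\<And>x y. barrier (1 / c) M ((u (x, t) - u (y, t)) / 2) t \<le> norm (x - y) / 2 + e"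
    and touch: "barrier (1 / c) M ((u (x, t) - u (y, t)) / 2) t = norm (x - y) / 2 + e"
    and time: "\<And>s. 0 < s \<Longrightarrow> s < t \<Longrightarrow> barrier (1 / c) M ((u (x, s) - u (y, s)) / 2) s \<le> norm (x - y) / 2 + e"
  shows False
proof -
  define K where "K = 1 / c"
  have K: "K > 0" "4 * t \<le> K * M ^ 3" "t \<le> K * M\<^sup>2" using c t by (auto simp: K_def)
  note space = space[folded K_def] and touch = touch[folded K_def] and time = time[folded K_def]
  have t0: "0 \<le> t" using t by simp
  note bd = bound[OF t0 t(2)]
  have zM: "\<bar>(u (x, t) - u (y, t)) / 2\<bar> \<le> M" for x y using bd[of x] bd[of y] by simp
  define z where "z = (u (x, t) - u (y, t)) / 2"
  define d where "d = norm (x - y)"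
  define w where "w = sgn (x - y)"
  have d: "d > 0" using \<open>x \<noteq> y\<close> by (simp add: d_def)
  have w1: "norm w = 1" and w3: "x - y = d *\<^sub>R w"
    using \<open>x \<noteq> y\<close> by (simp_all add: w_def d_def norm_sgn) (simp add: sgn_div_norm)
  have w: "norm w = 1" "w \<bullet> w = 1" "x - y = d *\<^sub>R w" using w1 w3 by (simp_all add: norm_eq_1)
  define g where "g = barrier_z K M z t"
  have g: "0 < g" "g \<le> 1" using barrier_z_bounds[OF zM K(1) M t(1) K(2)] by (auto simp: g_def z_def)
  have norm_deriv: "((\<lambda>s. norm ((x - y) + s *\<^sub>R v)) has_real_derivative v \<bullet> w) (at 0)" for v
    using has_derivative_along_line[of norm "\<lambda>h. h \<bullet> sgn (x - y)" "x - y" 0 v UNIV UNIV]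
      has_derivative_norm[of "x - y"] \<open>x \<noteq> y\<close> by (simp add: w_def)
  \<comment> \<open>First variation in x alone: it forces w = g Du(x), so Du(x) has length 1 / g and
    points along x - y. The variation in y gives the same vector.\<close>
  have "v \<bullet> w / 2 - g * (spatial_grad u T x t \<bullet> v / 2) = 0" for v
  proof (rule DERIV_local_min)
    let ?f = "\<lambda>s. norm ((x - y) + s *\<^sub>R v) / 2 + e - barrier K M ((u (x + s *\<^sub>R v, t) - u (y, t)) / 2) t"
    have "((\<lambda>s. (u (x + s *\<^sub>R v, t) - u (y, t)) / 2) has_real_derivative spatial_grad u T x t \<bullet> v / 2) (at 0)"
      using has_derivative_space[OF t0 t(2), of x v 0] by (auto intro!: derivative_eq_intros)
    from barrier_has_derivative_z[OF this t(1), of K M]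
    show "(?f has_real_derivative v \<bullet> w / 2 - g * (spatial_grad u T x t \<bullet> v / 2)) (at 0)"
      using norm_deriv[of v] by (auto intro!: derivative_eq_intros simp: g_def z_def)
    show "\<forall>s. \<bar>0 - s\<bar> < 1 \<longrightarrow> ?f 0 \<le> ?f s"
      using space[of "x + _ *\<^sub>R v" y] touch by (auto simp: algebra_simps)
  qed simp
  then have "v \<bullet> w = v \<bullet> (g *\<^sub>R spatial_grad u T x t)" for v
    by (simp add: inner_commute)
  then have "w = g *\<^sub>R spatial_grad u T x t" by (subst vector_eq_ldot[symmetric]) blast
  then have gx: "spatial_grad u T x t = (1 / g) *\<^sub>R w" using g by simp
  have "(- v) \<bullet> w / 2 + g * (spatial_grad u T y t \<bullet> v / 2) = 0" for v
  proof (rule DERIV_local_min)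
    let ?f = "\<lambda>s. norm ((x - y) + s *\<^sub>R (- v)) / 2 + e - barrier K M ((u (x, t) - u (y + s *\<^sub>R v, t)) / 2) t"
    have "((\<lambda>s. (u (x, t) - u (y + s *\<^sub>R v, t)) / 2) has_real_derivative - (spatial_grad u T y t \<bullet> v / 2)) (at 0)"
      using has_derivative_space[OF t0 t(2), of y v 0] by (auto intro!: derivative_eq_intros)
    from barrier_has_derivative_z[OF this t(1), of K M]
    show "(?f has_real_derivative (- v) \<bullet> w / 2 + g * (spatial_grad u T y t \<bullet> v / 2)) (at 0)"
      using norm_deriv[of "- v"] by (auto intro!: derivative_eq_intros simp: g_def z_def)
    show "\<forall>s. \<bar>0 - s\<bar> < 1 \<longrightarrow> ?f 0 \<le> ?f s"
      using space[of x "y + _ *\<^sub>R v"] touch by (auto simp: algebra_simps)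
  qed simp
  then have "v \<bullet> w = v \<bullet> (g *\<^sub>R spatial_grad u T y t)" for v
    by (simp add: inner_commute)
  then have "w = g *\<^sub>R spatial_grad u T y t" by (subst vector_eq_ldot[symmetric]) blast
  then have gy: "spatial_grad u T y t = (1 / g) *\<^sub>R w" using g by simp
  define p where "p = (1 / g) *\<^sub>R w"
  define H where "H = (\<lambda>i j. spatial_hess u T x t i j - spatial_hess u T y t i j)"
  let ?q = "\<lambda>v. \<Sum>i\<in>UNIV. \<Sum>j\<in>UNIV. H i j * v $ i * v $ j"
  have q_eq: "?q v = (\<Sum>i\<in>UNIV. \<Sum>j\<in>UNIV. spatial_hess u T x t i j * v $ i * v $ j)
      - (\<Sum>i\<in>UNIV. \<Sum>j\<in>UNIV. spatial_hess u T y t i j * v $ i * v $ j)" for v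
    by (simp add: H_def left_diff_distrib sum_subtractf)
  have par: "0 \<le> - ?q v" for v
  proof (rule second_derivative_test_min(2)[of 1])
    let ?f = "\<lambda>s. u (y + s *\<^sub>R v, t) - u (x + s *\<^sub>R v, t)"
    let ?f' = "\<lambda>s. spatial_grad u T (y + s *\<^sub>R v) t \<bullet> v - spatial_grad u T (x + s *\<^sub>R v) t \<bullet> v"
    show "(?f has_real_derivative ?f' s) (at s)" for s
      by (intro DERIV_diff has_derivative_space t0 t)
    show "(?f' has_real_derivative - ?q v) (at 0)"
      unfolding q_eq minus_diff_eq by (intro DERIV_diff has_derivative_space2 t0 t)
    \<comment> \<open>The distance is unchanged, so a larger height difference would, by strict
      monotonicity of the barrier, violate \<open>space\<close>.\<close>
    show "?f 0 \<le> ?f s" for s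
    proof (rule ccontr)
      assume "\<not> ?f 0 \<le> ?f s"
      then have "barrier K M z t < barrier K M ((u (x + s *\<^sub>R v, t) - u (y + s *\<^sub>R v, t)) / 2) t"
        using zM[of "x + s *\<^sub>R v" "y + s *\<^sub>R v"] K M t by (intro barrier_strict_mono) (auto simp: z_def)
      then show False
        using space[of "x + s *\<^sub>R v" "y + s *\<^sub>R v"] touch by (simp add: z_def)
    qed
  qed simp
  \<comment> \<open>Each point moves at unit speed, so half the distance is d / 2 + s, which is
    linear while |s| < d / 2 keeps the points from crossing. Both gradients are w / g, hence the
    height variable has derivative 1 / g.\<close>
  have apart: "0 \<le> - (barrier_zz K M z t * (1 / g)\<^sup>2 + g * (?q w / 2))"
  proof (rule second_derivative_test_min(2)[of "d / 2"])
    let ?z = "\<lambda>s. (u (x + s *\<^sub>R w, t) - u (y + s *\<^sub>R (- w), t)) / 2"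
    let ?z' = "\<lambda>s. (spatial_grad u T (x + s *\<^sub>R w) t \<bullet> w - spatial_grad u T (y + s *\<^sub>R (- w)) t \<bullet> (- w)) / 2"
    let ?f = "\<lambda>s. d / 2 + s + e - barrier K M (?z s) t"
    let ?f' = "\<lambda>s. 1 - barrier_z K M (?z s) t * ?z' s"
    have dz: "(?z has_real_derivative ?z' s) (at s)" for s
      by (intro DERIV_cdivide DERIV_diff has_derivative_space t0 t)
    have "?q (- w) = ?q w" by simp
    then have "(?z' has_real_derivative ?q w / 2) (at 0)"
      using has_derivative_space2[OF t0 t(2), of x w] has_derivative_space2[OF t0 t(2), of y "- w"]
      unfolding q_eq[of w] by (intro DERIV_cdivide DERIV_diff) auto
    moreover have "?z 0 = z" "?z' 0 = 1 / g" by (simp_all add: z_def gx gy w)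
    ultimately show "(?f' has_real_derivative - (barrier_zz K M z t * (1 / g)\<^sup>2 + g * (?q w / 2))) (at 0)"
      using DERIV_diff[OF DERIV_const DERIV_mult[OF barrier_z_has_derivative_z[OF dz[of 0] t(1), of K M]], of ?z' "?q w / 2" 1]
      by (simp add: g_def power2_eq_square algebra_simps)
    show "(?f has_real_derivative ?f' s) (at s)" for s
      using barrier_has_derivative_z[OF dz[of s] t(1), of K M] by (auto intro!: derivative_eq_intros)
    show "?f 0 \<le> ?f s" if "\<bar>s\<bar> < d / 2" for s
    proof -
      have "(x + s *\<^sub>R w) - (y + s *\<^sub>R (- w)) = (d + 2 * s) *\<^sub>R w"
        using w(3) by (simp add: algebra_simps flip: scaleR_2)
      then have "norm ((x + s *\<^sub>R w) - (y + s *\<^sub>R (- w))) = d + 2 * s"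
        using that w by simp
      then show ?thesis
        using space[of "x + s *\<^sub>R w" "y + s *\<^sub>R (- w)"] touch by (simp add: d_def add_divide_distrib)
    qed
  qed (use d in simp)
  \<comment> \<open>The guaranteed coefficient in the direction w. As |p| = 1 / g, its factor g^2
    cancels the (1 / g)^2 of \<open>apart\<close>.\<close>
  define m where "m = c / (1 + (norm p)\<^sup>2)"
  have m_eq: "m = c * g\<^sup>2 / (g\<^sup>2 + 1)"
    using g w by (simp add: m_def p_def field_simps power2_eq_square)
  define tr where "tr = (\<Sum>i\<in>UNIV. \<Sum>j\<in>UNIV. a p i j * H i j)"
  have "0 \<le> (\<Sum>i\<in>UNIV. \<Sum>j\<in>UNIV. (a p i j - m * w $ i * w $ j) * (- H i j))"
  proof (rule trace_psd_nonneg)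
    show "a p i j - m * w $ i * w $ j = a p j i - m * w $ j * w $ i" for i j
      using a_sym[of p i j] by simp
    show "0 \<le> (\<Sum>i\<in>UNIV. \<Sum>j\<in>UNIV. - H i j * v i * v j)" for v
      using par[of "\<chi> i. v i"] by (simp add: sum_negf)
    show "0 \<le> (\<Sum>i\<in>UNIV. \<Sum>j\<in>UNIV. (a p i j - m * w $ i * w $ j) * v i * v j)" for v
    proof -
      define b where "b = (\<chi> i. v i)"
      have bw: "b \<bullet> w = (\<Sum>i\<in>UNIV. v i * w $ i)" by (simp add: b_def inner_vec_def)
      have "(\<Sum>i\<in>UNIV. \<Sum>j\<in>UNIV. (m * w $ i * w $ j) * v i * v j) = m * (b \<bullet> w)\<^sup>2"
        by (simp add: power2_eq_square bw sum_product sum_distrib_left mult_ac)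
      then have "(\<Sum>i\<in>UNIV. \<Sum>j\<in>UNIV. (a p i j - m * w $ i * w $ j) * v i * v j)
          = (\<Sum>i\<in>UNIV. \<Sum>j\<in>UNIV. a p i j * b $ i * b $ j) - m * (b \<bullet> w)\<^sup>2"
        by (simp add: left_diff_distrib sum_subtractf b_def)
      \<comment> \<open>Since p is parallel to w, the right side equals c (|b|^2 - (b . w)^2) + m (b
        . w)^2.\<close>
      moreover have "m * (b \<bullet> w)\<^sup>2 \<le> c * ((norm b)\<^sup>2 - (b \<bullet> p)\<^sup>2 / (1 + (norm p)\<^sup>2))"
      proof -
        have "(b \<bullet> w)\<^sup>2 \<le> (norm b)\<^sup>2"
          using Cauchy_Schwarz_ineq[of b w] w by (simp add: power2_norm_eq_inner)
        moreover have "m * (b \<bullet> w)\<^sup>2 = c * ((b \<bullet> w)\<^sup>2 - (b \<bullet> p)\<^sup>2 / (1 + (norm p)\<^sup>2))"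
        proof -
          have "(b \<bullet> p)\<^sup>2 = (norm p)\<^sup>2 * (b \<bullet> w)\<^sup>2"
            using g w by (simp add: p_def power_divide)
          moreover have "1 + (norm p)\<^sup>2 > 0" by (simp add: add_pos_nonneg)
          ultimately show ?thesis by (simp add: m_def field_simps)
        qed
        ultimately show ?thesis using c by simp
      qed
      ultimately show ?thesis using a_elliptic[of b p] by linarith
    qed
  qed
  moreover have "(\<Sum>i\<in>UNIV. \<Sum>j\<in>UNIV. (a p i j - m * w $ i * w $ j) * (- H i j)) = m * ?q w - tr"
    unfolding tr_def sum_distrib_left sum_subtractf[symmetric] by (intro sum.cong refl) (simp add: algebra_simps)
  ultimately have tr: "tr \<le> m * ?q w" by simp
  \<comment> \<open>The gap is nonnegative before t and zero at t, so it cannot be increasing into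
    t. Only earlier times are compared, which includes the case t = T.\<close>
  have "0 \<le> g * (tr / 2) + barrier_t K M z t"
  proof (rule ccontr)
    let ?k = "\<lambda>s. norm (x - y) / 2 + e - barrier K M ((u (x, s) - u (y, s)) / 2) s"
    assume n: "\<not> 0 \<le> g * (tr / 2) + barrier_t K M z t"
    have "D1 u (UNIV \<times> {0..T}) (x, t) (0, 1) - D1 u (UNIV \<times> {0..T}) (y, t) (0, 1) = tr"
      using t0 t by (simp add: equation gx gy tr_def H_def p_def right_diff_distrib sum_subtractf)
    then have "((\<lambda>s. (u (x, s) - u (y, s)) / 2) has_real_derivative tr / 2) (at t within {0..T})"
      using DERIV_diff[OF has_derivative_time[OF t0 t(2), of x] has_derivative_time[OF t0 t(2), of y]]
      by (intro DERIV_cdivide) simp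
    from barrier_has_derivative_t[OF this t(1), of K M]
    have der: "(?k has_real_derivative - (g * (tr / 2) + barrier_t K M z t)) (at t within {0..T})"
      by (auto intro!: derivative_eq_intros simp: g_def z_def)
    have "0 < - (g * (tr / 2) + barrier_t K M z t)" using n by linarith
    from has_real_derivative_pos_inc_left[OF der this]
    obtain r where r: "r > 0" "\<And>h. 0 < h \<Longrightarrow> t - h \<in> {0..T} \<Longrightarrow> h < r \<Longrightarrow> ?k (t - h) < ?k t"
      by blast
    define h where "h = min r t / 2"
    have "0 < h" "h < r" "h < t" using r t by (auto simp: h_def)
    then show False using r(2)[of h] time[of "t - h"] touch t by auto
  qed
  \<comment> \<open>The contradiction is the chain G_t \<ge> - g tr / 2 \<ge> m G_zz / g^2 = c G_zz
    / (1 + g^2) \<ge> c G_zz / 2 > G_t.\<close>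
  moreover have "g * (tr / 2) \<le> m * (g * (?q w / 2))"
    using mult_left_mono[OF tr, of "g / 2"] g by (simp add: mult_ac)
  moreover have "m * (g * (?q w / 2)) \<le> m * - (barrier_zz K M z t * (1 / g)\<^sup>2)"
    using apart c by (intro mult_left_mono) (auto simp: m_def add_pos_nonneg)
  moreover have "m * (barrier_zz K M z t * (1 / g)\<^sup>2) = c * barrier_zz K M z t / (g\<^sup>2 + 1)"
    using g by (simp add: m_eq power_divide)
  moreover have "c * barrier_zz K M z t / 2 \<le> c * barrier_zz K M z t / (g\<^sup>2 + 1)"
  proof -
    have "g\<^sup>2 \<le> 1" using g by (simp add: power_le_one)
    moreover have "0 < 2 * g\<^sup>2 + 2" by (simp add: add_nonneg_pos)
    ultimately show ?thesis
      using barrier_subsolution(1)[OF zM K(1) M t(1) K(3)] c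
      by (intro divide_left_mono) (auto simp: z_def)
  qed
  moreover have "barrier_t K M z t < c * barrier_zz K M z t / 2"
    using barrier_subsolution(2)[OF zM K(1) M t(1) K(3), of x y] c by (simp add: z_def K_def mult.commute)
  ultimately show False by linarith
qed

text \<open>A slack e > 0 makes the inequality strict both on the diagonal and for small times.
  Periodicity reduces its violations to a compact set, on which the time coordinate attains a
  minimum; that first time is a touching excluded by \<open>no_touching\<close>. Finally e is
  arbitrary.\<close>

lemma two_point_estimate:
  assumes t1: "0 < t1" "t1 \<le> T" "4 * t1 \<le> M ^ 3 / c" "t1 \<le> M\<^sup>2 / c"
    and L: "is_lattice L"
    and per: "\<And>l x t. l \<in> L \<Longrightarrow> 0 \<le> t \<Longrightarrow> t \<le> T \<Longrightarrow> u (x + l, t) = u (x, t)"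
  shows "barrier (1 / c) M ((u (x1, t1) - u (y1, t1)) / 2) t1 \<le> norm (x1 - y1) / 2"
proof (rule field_le_epsilon)
  fix e :: real assume e: "e > 0"
  define K where "K = 1 / c"
  have K: "K > 0" using c by (simp add: K_def)
  define \<Phi> where "\<Phi> = (\<lambda>x y s. norm (x - y) / 2 + e - barrier K M ((u (x, s) - u (y, s)) / 2) s)"
  have zM: "\<bar>(u (x, s) - u (y, s)) / 2\<bar> \<le> M" if "0 \<le> s" "s \<le> T" for x y s
    using bound[OF that, of x] bound[OF that, of y] by simp
  \<comment> \<open>Before this time the barrier, bounded by s / (K M^2), is below e for all pairs
    of points.\<close>
  define \<tau> where "\<tau> = min t1 (K * M\<^sup>2 * e / 2)"
  have \<tau>: "0 < \<tau>" "\<tau> \<le> t1" using t1 K M e by (auto simp: \<tau>_def)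
  have early: "\<Phi> x y s > 0" if "0 < s" "s < \<tau>" for x y s
  proof -
    have "s / (K * M\<^sup>2) < e"
      using that K M e by (simp add: \<tau>_def pos_divide_less_eq mult_ac)
    moreover have "0 \<le> s" "s \<le> T" using that \<tau> t1 by auto
    ultimately show ?thesis
      using barrier_le(1)[OF zM[of s x y] K M that(1)] norm_ge_zero[of "x - y"]
      unfolding \<Phi>_def by linarith
  qed
  have near: "norm (x - y) \<le> 2" if "\<Phi> x y s \<le> 0" "0 < s" "s \<le> T" for x y s
    using barrier_le(2)[OF zM[of s x y] K M that(2)] that e by (simp add: \<Phi>_def)
  have shift: "\<Phi> (x + l) (y + l) s = \<Phi> x y s" if "l \<in> L" "0 \<le> s" "s \<le> T" for x y s l
    using per[OF that] by (simp add: \<Phi>_def)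
  obtain R where R: "\<And>x. \<exists>l\<in>L. norm (x + l) \<le> R" using is_lattice_cobounded[OF L] by blast
  \<comment> \<open>Pairs are recorded as (x, y - x): a lattice shift changes only the first entry,
    and the second is bounded by \<open>near\<close>.\<close>
  define Q where "Q = (cball 0 R \<times> cball 0 2 :: ((real^'n) \<times> (real^'n)) set) \<times> {\<tau>..t1}"
  define \<Psi> where "\<Psi> = (\<lambda>q. \<Phi> (fst (fst q)) (fst (fst q) + snd (fst q)) (snd q))"
  define Bad where "Bad = {q \<in> Q. \<Psi> q \<le> 0}"
  have Q: "compact Q" unfolding Q_def by (intro compact_Times compact_cball compact_Icc)
  have "continuous_on Q \<Psi>"
    unfolding \<Psi>_def \<Phi>_def barrier_def
    by (intro continuous_intros continuous_on_compose2[OF continuous_u]) (use t1 \<tau> in \<open>auto simp: Q_def\<close>)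
  then have "closed Bad"
    unfolding Bad_def using compact_imp_closed[OF Q] by (intro continuous_on_closed_Collect_le continuous_intros)
  then have Bad: "compact Bad"
    using compact_Int_closed[OF Q, of Bad] by (simp add: Bad_def Int_absorb1 subset_iff Int_def) 
  have to_Bad: "\<exists>q\<in>Bad. snd q = s" if neg: "\<Phi> x y s \<le> 0" and s: "\<tau> \<le> s" "s \<le> t1" for x y s
  proof -
    obtain l where l: "l \<in> L" "norm (x + l) \<le> R" using R by blast
    have s': "0 < s" "0 \<le> s" "s \<le> T" using s \<tau> t1 by auto
    have "((x + l, y - x), s) \<in> Q"
      using l(2) near[OF neg s'(1,3)] s by (simp add: Q_def norm_minus_commute add.commute)
    moreover have "\<Psi> ((x + l, y - x), s) \<le> 0"
      using shift[OF l(1) s'(2,3), of x y] neg by (simp add: \<Psi>_def add_ac)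
    ultimately show ?thesis unfolding Bad_def by (intro bexI[of _ "((x + l, y - x), s)"]) auto
  qed
  have "\<Phi> x1 y1 t1 \<ge> 0"
  proof (rule ccontr)
    assume "\<not> \<Phi> x1 y1 t1 \<ge> 0"
    then have "\<Phi> x1 y1 t1 \<le> 0" by simp
    from to_Bad[OF this \<tau>(2)] have "Bad \<noteq> {}" by auto
    then obtain q where q: "q \<in> Bad" "\<And>r. r \<in> Bad \<Longrightarrow> snd q \<le> snd r"
      using continuous_attains_inf[OF Bad _ continuous_on_snd[OF continuous_on_id]] by auto
    define x y t where "x = fst (fst q)" and "y = fst (fst q) + snd (fst q)" and "t = snd q"
    have t: "\<tau> \<le> t" "t \<le> t1" and neg: "\<Phi> x y t \<le> 0"
      using q(1) by (auto simp: Bad_def Q_def \<Psi>_def x_def y_def t_def)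
    have t': "0 < t" "0 \<le> t" "t \<le> T" using t \<tau> t1 by auto
    have before: "\<Phi> x y s > 0" if s: "0 < s" "s < t" for x y s
    proof (cases "s < \<tau>")
      case False
      show ?thesis
      proof (rule ccontr)
        assume "\<not> \<Phi> x y s > 0"
        then obtain r where "r \<in> Bad" "snd r = s"
          using to_Bad[of x y s] False s t by auto
        then show False using q(2)[of r] s by (simp add: t_def)
      qed
    qed (use early s in blast)
    \<comment> \<open>At the first bad time itself nonnegativity is inherited from earlier times by
      continuity in time, so the bad pair has value exactly 0.\<close>
    have at: "\<Phi> x y t \<ge> 0" for x y
    proof -
      have "((\<lambda>s. (u (x, s) - u (y, s)) / 2) has_real_derivative
          (D1 u (UNIV \<times> {0..T}) (x, t) (0, 1) - D1 u (UNIV \<times> {0..T}) (y, t) (0, 1)) / 2) (at t within {0..T})"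
        by (intro DERIV_cdivide DERIV_diff has_derivative_time t')
      from barrier_has_derivative_t[OF this t'(1), of K M]
      have "((\<lambda>s. barrier K M ((u (x, s) - u (y, s)) / 2) s) \<longlongrightarrow> barrier K M ((u (x, t) - u (y, t)) / 2) t)
          (at t within {0..T})"
        using DERIV_continuous continuous_within by blast
      then have "((\<lambda>s. \<Phi> x y s) \<longlongrightarrow> \<Phi> x y t) (at t within {0..T})"
        unfolding \<Phi>_def by (intro tendsto_intros)
      then have "((\<lambda>s. \<Phi> x y s) \<longlongrightarrow> \<Phi> x y t) (at t within {0<..<t})"
        by (rule tendsto_within_subset) (use t' in auto)
      moreover have "\<forall>\<^sub>F s in at t within {0<..<t}. 0 \<le> \<Phi> x y s"
        using before by (auto simp: eventually_at_filter intro!: always_eventually less_imp_le)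
      moreover have "\<not> trivial_limit (at t within {0<..<t})"
        using islimpt_greaterThanLessThan2[OF t'(1)] by (simp add: trivial_limit_within)
      ultimately show ?thesis by (rule tendsto_lowerbound)
    qed
    have zero: "\<Phi> x y t = 0" using at[of x y] neg by simp
    have "x \<noteq> y" using zero e by (auto simp: \<Phi>_def barrier_def)
    moreover have "4 * t \<le> M ^ 3 / c" "t \<le> M\<^sup>2 / c" using t t1 by auto
    moreover have "barrier (1 / c) M ((u (x, t) - u (y, t)) / 2) t \<le> norm (x - y) / 2 + e" for x y
      using at[of x y] by (simp add: \<Phi>_def K_def)
    moreover have "barrier (1 / c) M ((u (x, t) - u (y, t)) / 2) t = norm (x - y) / 2 + e"
      using zero by (simp add: \<Phi>_def K_def)
    moreover have "barrier (1 / c) M ((u (x, s) - u (y, s)) / 2) s \<le> norm (x - y) / 2 + e"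
      if "0 < s" "s < t" for s
      using before[OF that, of x y] by (simp add: \<Phi>_def K_def)
    ultimately show False using no_touching[OF t'(1,3), of x y e] by blast
  qed
  then show "barrier (1 / c) M ((u (x1, t1) - u (y1, t1)) / 2) t1 \<le> norm (x1 - y1) / 2 + e"
    by (simp add: \<Phi>_def K_def)
qed

lemma gradient_estimate:
  assumes t: "0 < t" "t \<le> T" "4 * t \<le> M ^ 3 / c" "t \<le> M\<^sup>2 / c"
    and L: "is_lattice L"
    and per: "\<And>l x t. l \<in> L \<Longrightarrow> 0 \<le> t \<Longrightarrow> t \<le> T \<Longrightarrow> u (x + l, t) = u (x, t)"
  shows "norm (spatial_grad u T x t) \<le> c * t / (4 * M) * exp (4 * M\<^sup>2 / (c * t))"
proof -
  define v where "v = spatial_grad u T x t"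
  define g where "g = barrier_z (1 / c) M 0 t"
  have g: "g = 4 * M / (c * t) * exp (- (4 * M\<^sup>2 / (c * t)))"
    by (simp add: g_def barrier_z_def power_mult_distrib)
  have g0: "g > 0" using c M t by (simp add: g)
  have t0: "0 \<le> t" using t by simp
  \<comment> \<open>Both sides of the two-point estimate vanish on the diagonal, so their slopes can
    be compared there. Moving along the gradient v itself gives slope g |v|^2 / 2 for the barrier
    and |v| / 2 for half the distance.\<close>
  have "0 \<le> norm v / 2 - g * ((v \<bullet> v) / 2)"
  proof (rule ccontr)
    let ?f = "\<lambda>s. s * norm v / 2 - barrier (1 / c) M ((u (x + s *\<^sub>R v, t) - u (x, t)) / 2) t"
    assume n: "\<not> ?thesis"
    have "((\<lambda>s. (u (x + s *\<^sub>R v, t) - u (x, t)) / 2) has_real_derivative (v \<bullet> v) / 2) (at 0)"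
      using has_derivative_space[OF t0 t(2), of x v 0] by (auto intro!: derivative_eq_intros simp: v_def)
    from barrier_has_derivative_z[OF this t(1), of "1 / c" M]
    have der: "(?f has_real_derivative norm v / 2 - g * ((v \<bullet> v) / 2)) (at 0)"
      by (auto intro!: derivative_eq_intros simp: g_def)
    obtain d where d: "d > 0" "\<And>h. 0 < h \<Longrightarrow> h < d \<Longrightarrow> ?f (0 + h) < ?f 0"
      using DERIV_neg_dec_right[OF der] n by force
    have "?f (d / 2) < ?f 0" using d(2)[of "d / 2"] d(1) by simp
    moreover have "?f 0 = 0" by (simp add: barrier_def)
    moreover have "0 \<le> ?f (d / 2)"
      using two_point_estimate[OF t L per, of "x + (d / 2) *\<^sub>R v" x] d(1) by simp
    ultimately show False by linarith
  qed
  then have "g * norm v * norm v \<le> norm v" by (simp add: dot_square_norm power2_eq_square)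
  then have "g * norm v \<le> 1" by (cases "norm v = 0") (auto simp: mult_le_cancel_right1)
  then have "norm v \<le> 1 / g" using g0 by (simp add: field_simps)
  also have "1 / g = c * t / (4 * M) * exp (4 * M\<^sup>2 / (c * t))"
    by (simp add: g exp_minus divide_simps)
  finally show ?thesis by (simp add: v_def)
qed

end

section \<open>Anisotropic mean curvature flow\<close>

lemma nu_of_eq: "nu_of u T x t = (- 1, spatial_grad u T x t)"
  by (simp add: nu_of_def phi_def phi0_def prod_eq_iff fst_sum snd_sum spatial_grad_def vec_eq_iff axis_def if_distrib cong: if_cong)

text \<open>For the conormal (-1, p) and a horizontal vector (0, v) the squared norm is 1 + |p|^2
  and the inner product v . p. The radial direction is never horizontal, so the restricted form is
  positive definite, though not uniformly in p.\<close>

lemma standing_F_coefficients: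
  fixes F :: "real \<times> (real^'n) \<Rightarrow> real"
  assumes F: "standing_F F"
  obtains c where "c > 0"
    "\<And>p v. c * ((norm v)\<^sup>2 - (v \<bullet> p)\<^sup>2 / (1 + (norm p)\<^sup>2))
      \<le> (\<Sum>i\<in>UNIV. \<Sum>j\<in>UNIV. F (- 1, p) * D2 F (- {0}) (- 1, p) (phi i) (phi j) * v $ i * v $ j)"
    "\<And>p i j. D2 F (- {0}) (- 1, p) (phi i) (phi j) = D2 F (- {0}) (- 1, p) (phi j) (phi i)"
proof -
  obtain c where c: "c > 0"
    "\<And>v w. v \<noteq> 0 \<Longrightarrow> c * ((norm w)\<^sup>2 - (w \<bullet> v)\<^sup>2 / (norm v)\<^sup>2) \<le> F v * D2 F (- {0}) v w w"
    using standing_F_elliptic[OF F] by blast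
  have nz: "(- 1, p) \<noteq> (0 :: real \<times> (real^'n))" for p by (simp add: zero_prod_def)
  have sym: "D2 F (- {0}) (- 1, p) v w = D2 F (- {0}) (- 1, p) w v" for p v w
    by (intro D2_symmetric standing_F_differentiable[OF F]) (use nz in auto)
  show ?thesis
  proof (rule that[OF c(1) _ sym])
    fix p v :: "real^'n"
    have lin: "linear (D2 F (- {0}) (- 1, p) w)" for w
      using D2_has_derivative[OF standing_F_differentiable(2)[OF F nz]] has_derivative_linear by blast
    have "(0, v) = (\<Sum>i\<in>UNIV. v $ i *\<^sub>R phi i)"
      by (simp add: prod_eq_iff fst_sum snd_sum phi_def basis_expansion scalar_mult_eq_scaleR[symmetric])
    then have ex: "D2 F (- {0}) (- 1, p) w (0, v) = (\<Sum>i\<in>UNIV. v $ i * D2 F (- {0}) (- 1, p) w (phi i))" for w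
      by (simp only: linear_sum[OF lin] linear_scale[OF lin] real_scaleR_def)
    have "D2 F (- {0}) (- 1, p) (0, v) (0, v)
        = (\<Sum>i\<in>UNIV. v $ i * (\<Sum>j\<in>UNIV. v $ j * D2 F (- {0}) (- 1, p) (phi i) (phi j)))"
      by (subst ex, subst sym, subst ex) simp
    then have "F (- 1, p) * D2 F (- {0}) (- 1, p) (0, v) (0, v)
        = (\<Sum>i\<in>UNIV. \<Sum>j\<in>UNIV. F (- 1, p) * D2 F (- {0}) (- 1, p) (phi i) (phi j) * v $ i * v $ j)"
      by (simp add: sum_distrib_left mult_ac)
    moreover have "(norm (0::real, v))\<^sup>2 = (norm v)\<^sup>2" "(0::real, v) \<bullet> (- 1, p) = v \<bullet> p"
      "(norm (- 1::real, p))\<^sup>2 = 1 + (norm p)\<^sup>2" by (simp_all add: norm_Pair)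
    ultimately show "c * ((norm v)\<^sup>2 - (v \<bullet> p)\<^sup>2 / (1 + (norm p)\<^sup>2))
      \<le> (\<Sum>i\<in>UNIV. \<Sum>j\<in>UNIV. F (- 1, p) * D2 F (- {0}) (- 1, p) (phi i) (phi j) * v $ i * v $ j)"
      using c(2)[OF nz, of "(0, v)" p] by simp
  qed
qed

text \<open>The constant is obtained before u, T, L and M are introduced, so it depends on F
  alone.\<close>

lemma AMCF_gradient_estimate:
  fixes F :: "real \<times> (real^'n) \<Rightarrow> real"
  assumes F: "standing_F F"
  obtains c where "c > 0"
    "\<And>u T L M t x. C3_on u (UNIV \<times> {0..T}) \<Longrightarrow> solves_AMCF F u T \<Longrightarrow> M > 0 \<Longrightarrow>
      (\<And>x t. 0 \<le> t \<Longrightarrow> t \<le> T \<Longrightarrow> \<bar>u (x, t)\<bar> \<le> M) \<Longrightarrow> is_lattice L \<Longrightarrow>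
      (\<And>l x t. l \<in> L \<Longrightarrow> 0 \<le> t \<Longrightarrow> t \<le> T \<Longrightarrow> u (x + l, t) = u (x, t)) \<Longrightarrow>
      0 < t \<Longrightarrow> t \<le> T \<Longrightarrow> 4 * t \<le> M ^ 3 / c \<Longrightarrow> t \<le> M\<^sup>2 / c \<Longrightarrow>
      norm (spatial_grad u T x t) \<le> c * t / (4 * M) * exp (4 * M\<^sup>2 / (c * t))"
proof -
  obtain c where c: "c > 0"
    "\<And>p v. c * ((norm v)\<^sup>2 - (v \<bullet> p)\<^sup>2 / (1 + (norm p)\<^sup>2))
      \<le> (\<Sum>i\<in>UNIV. \<Sum>j\<in>UNIV. F (- 1, p) * D2 F (- {0}) (- 1, p) (phi i) (phi j) * v $ i * v $ j)"
    "\<And>p i j. D2 F (- {0}) (- 1, p) (phi i) (phi j) = D2 F (- {0}) (- 1, p) (phi j) (phi i)"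
    using standing_F_coefficients[OF F] by blast
  show ?thesis
  proof (rule that[OF c(1)])
    fix u :: "(real^'n) \<times> real \<Rightarrow> real" and T M t :: real and L :: "(real^'n) set" and x
    assume u: "C3_on u (UNIV \<times> {0..T})" and sol: "solves_AMCF F u T" and M: "M > 0"
      and bd: "\<And>x t. 0 \<le> t \<Longrightarrow> t \<le> T \<Longrightarrow> \<bar>u (x, t)\<bar> \<le> M" and L: "is_lattice L"
      and per: "\<And>l x t. l \<in> L \<Longrightarrow> 0 \<le> t \<Longrightarrow> t \<le> T \<Longrightarrow> u (x + l, t) = u (x, t)"
      and t: "0 < t" "t \<le> T" "4 * t \<le> M ^ 3 / c" "t \<le> M\<^sup>2 / c"
    interpret quasilinear_solution u T c M "\<lambda>p i j. F (- 1, p) * D2 F (- {0}) (- 1, p) (phi i) (phi j)"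
    proof
      show "u differentiable (at (x, t) within UNIV \<times> {0..T})"
        "(\<lambda>y. D1 u (UNIV \<times> {0..T}) y v) differentiable (at (x, t) within UNIV \<times> {0..T})"
        if "0 \<le> t" "t \<le> T" for x t v
        using u that unfolding C3_on_def by (meson SigmaI UNIV_I atLeastAtMost_iff)+
      show "D1 u (UNIV \<times> {0..T}) (x, t) (0, 1) = (\<Sum>i\<in>UNIV. \<Sum>j\<in>UNIV.
          F (- 1, spatial_grad u T x t) * D2 F (- {0}) (- 1, spatial_grad u T x t) (phi i) (phi j)
          * spatial_hess u T x t i j)" if "0 \<le> t" "t \<le> T" for x t
        using sol that unfolding solves_AMCF_def nu_of_eq spatial_hess_def by blast
    qed (use c M bd in auto)
    show "norm (spatial_grad u T x t) \<le> c * t / (4 * M) * exp (4 * M\<^sup>2 / (c * t))"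
      by (rule gradient_estimate[OF t L per])
  qed
qed

theorem theorem1:
  fixes F :: "real \<times> (real^'n) \<Rightarrow> real" and C1 :: real
  assumes "standing_F F"
    and "C1 > 0" and "SC F C1"
    and "C1\<^sup>2 < 4 / sqrt (real CARD('n))"
  shows "\<exists>A P q. A > 0 \<and> P > F (- phi0) \<and> q > 1 \<and>
    (\<forall>M>0. \<exists>T0>0. \<forall>T (u :: (real^'n) \<times> real \<Rightarrow> real) L.
       T > 0 \<longrightarrow> C3_on u (UNIV \<times> {0..T}) \<longrightarrow> solves_AMCF F u T \<longrightarrow>
       (\<forall>x t. 0 \<le> t \<and> t \<le> T \<longrightarrow> \<bar>u (x, t)\<bar> \<le> M) \<longrightarrow>
       is_lattice L \<longrightarrow>
       (\<forall>l\<in>L. \<forall>x t. 0 \<le> t \<and> t \<le> T \<longrightarrow> u (x + l, t) = u (x, t)) \<longrightarrow>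
       (\<forall>x t. 0 < t \<and> t \<le> min T T0 \<longrightarrow>
          F (nu_of u T x t)
            \<le> max (t powr (q / 2) * exp (A * q * (\<bar>u (x, t)\<bar> - 2 * M)\<^sup>2 / (4 * t))) P))"
proof -
  note F = assms(1)
  obtain c where c: "c > 0" and grad:
    "\<And>u T L M t x. C3_on u (UNIV \<times> {0..T}) \<Longrightarrow> solves_AMCF F u T \<Longrightarrow> M > 0 \<Longrightarrow>
      (\<And>x t. 0 \<le> t \<Longrightarrow> t \<le> T \<Longrightarrow> \<bar>u (x, t)\<bar> \<le> M) \<Longrightarrow> is_lattice L \<Longrightarrow>
      (\<And>l x t. l \<in> L \<Longrightarrow> 0 \<le> t \<Longrightarrow> t \<le> T \<Longrightarrow> u (x + l, t) = u (x, t)) \<Longrightarrow>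
      0 < t \<Longrightarrow> t \<le> T \<Longrightarrow> 4 * t \<le> M ^ 3 / c \<Longrightarrow> t \<le> M\<^sup>2 / c \<Longrightarrow>
      norm (spatial_grad u T x t) \<le> c * t / (4 * M) * exp (4 * M\<^sup>2 / (c * t))"
    using AMCF_gradient_estimate[OF F] by blast
  obtain b B where B: "B > 0" "\<And>v. F v \<le> B * norm v" using standing_F_norm_bounds[OF F] by metis
  define F0 where "F0 = F (- phi0)"
  have F0: "F0 > 0" unfolding F0_def
    by (rule standing_F_pos[OF F]) (simp add: phi0_def zero_prod_def)
  \<comment> \<open>The witnesses are A = 16 / c, q = 2 and P = F0 + 1. The exponent becomes 8 (|u|
    - 2M)^2 / (c t), at least 8 M^2 / (c t) because |u| \<le> M. That is twice the exponent of the
    gradient bound, and the spare exponential absorbs all constants.\<close>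
  have "\<exists>T0>0. \<forall>T (u :: (real^'n) \<times> real \<Rightarrow> real) L.
       T > 0 \<longrightarrow> C3_on u (UNIV \<times> {0..T}) \<longrightarrow> solves_AMCF F u T \<longrightarrow>
       (\<forall>x t. 0 \<le> t \<and> t \<le> T \<longrightarrow> \<bar>u (x, t)\<bar> \<le> M) \<longrightarrow>
       is_lattice L \<longrightarrow>
       (\<forall>l\<in>L. \<forall>x t. 0 \<le> t \<and> t \<le> T \<longrightarrow> u (x + l, t) = u (x, t)) \<longrightarrow>
       (\<forall>x t. 0 < t \<and> t \<le> min T T0 \<longrightarrow>
          F (nu_of u T x t)
            \<le> max (t powr (2 / 2) * exp (16 / c * 2 * (\<bar>u (x, t)\<bar> - 2 * M)\<^sup>2 / (4 * t))) (F0 + 1))"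
    if M: "M > 0" for M
  proof -
    \<comment> \<open>If R \<le> E, then c B / (2M) \<le> E and c F0 / (2 M^2) \<le> E, so the
      gradient part and F0 each take at most half of t E^2.\<close>
    define R where "R = c * B / (2 * M) + c * F0 / (2 * M\<^sup>2)"
    have R: "R > 0" using c B F0 M by (simp add: R_def add_pos_pos)
    \<comment> \<open>The first two entries are the time restrictions of the gradient estimate; the
      third gives R \<le> 4 M^2 / (c t) \<le> E.\<close>
    define T0 where "T0 = min (min (M ^ 3 / (4 * c)) (M\<^sup>2 / c)) (4 * M\<^sup>2 / (c * R))"
    have T0: "T0 > 0" using c M R by (simp add: T0_def)
    show ?thesis
    proof (intro exI[of _ T0] conjI T0 allI impI)
      fix T t and u :: "(real^'n) \<times> real \<Rightarrow> real" and L x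
      assume u: "C3_on u (UNIV \<times> {0..T})" "solves_AMCF F u T"
        and bd: "\<forall>x t. 0 \<le> t \<and> t \<le> T \<longrightarrow> \<bar>u (x, t)\<bar> \<le> M" and L: "is_lattice L"
        and per: "\<forall>l\<in>L. \<forall>x t. 0 \<le> t \<and> t \<le> T \<longrightarrow> u (x + l, t) = u (x, t)"
        and t: "0 < t \<and> t \<le> min T T0"
      have t': "0 < t" "t \<le> T" "4 * t \<le> M ^ 3 / c" "t \<le> M\<^sup>2 / c" "t \<le> 4 * M\<^sup>2 / (c * R)"
        using t by (auto simp: T0_def)
      define p where "p = spatial_grad u T x t"
      define E where "E = exp (4 * M\<^sup>2 / (c * t))"
      have E0: "E > 0" by (simp add: E_def)
      have "norm p \<le> c * t / (4 * M) * E"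
        unfolding p_def E_def by (rule grad[OF u M _ L]) (use bd per t' in auto)
      then have p: "B * norm p \<le> (c * B / (4 * M)) * (t * E)"
        using B(1) mult_left_mono[of "norm p" "c * t / (4 * M) * E" B] by (simp add: mult_ac)
      have X: "4 * M\<^sup>2 / (c * t) \<le> E"
        unfolding E_def using exp_ge_add_one_self[of "4 * M\<^sup>2 / (c * t)"] by linarith
      \<comment> \<open>The factor t is compensated by one exponential: t E stays bounded below as t
        tends to 0, so the fixed number F0 can be absorbed.\<close>
      have tE: "4 * M\<^sup>2 / c \<le> t * E" using X t' c by (simp add: field_simps)
      have "R \<le> 4 * M\<^sup>2 / (c * t)" using t' c R by (simp add: field_simps)
      with X have "R \<le> E" by simp
      moreover have "0 \<le> c * B / (2 * M)" "0 \<le> c * F0 / (2 * M\<^sup>2)" using c B F0 M by auto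
      ultimately have E: "c * B / (2 * M) \<le> E" "c * F0 / (2 * M\<^sup>2) \<le> E" unfolding R_def by linarith+
      have "(c * B / (4 * M)) * (t * E) \<le> (E / 2) * (t * E)"
        using divide_right_mono[OF E(1), of 2] t' E0 by (intro mult_right_mono) auto
      moreover have "F0 \<le> (E / 2) * (t * E)"
      proof -
        have "F0 = (c * F0 / (2 * M\<^sup>2) / 2) * (4 * M\<^sup>2 / c)" using c M by simp
        also have "\<dots> \<le> (E / 2) * (t * E)"
          using E(2) tE c F0 M E0 by (intro mult_mono divide_right_mono) auto
        finally show ?thesis .
      qed
      moreover have "F (nu_of u T x t) \<le> B * norm p + F0"
      proof -
        have "nu_of u T x t = (0, p) + (- phi0)" by (simp add: nu_of_eq p_def phi0_def)
        then have "F (nu_of u T x t) \<le> F (0, p) + F0"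
          using standing_F_triangle[OF F, of "(0, p)" "- phi0"] by (simp add: F0_def)
        then show ?thesis using B(2)[of "(0, p)"] by (simp add: norm_Pair)
      qed
      ultimately have "F (nu_of u T x t) \<le> t * (E * E)" using p by (simp add: mult_ac)
      also have "E * E = exp (8 * M\<^sup>2 / (c * t))" by (simp add: E_def flip: exp_add)
      also have "t * exp (8 * M\<^sup>2 / (c * t))
          \<le> t powr (2 / 2) * exp (16 / c * 2 * (\<bar>u (x, t)\<bar> - 2 * M)\<^sup>2 / (4 * t))"
      proof -
        have "\<bar>u (x, t)\<bar> \<le> M" using bd t' by simp
        then have "M\<^sup>2 \<le> (2 * M - \<bar>u (x, t)\<bar>)\<^sup>2" using M by (intro power_mono) auto
        then have "M\<^sup>2 \<le> (\<bar>u (x, t)\<bar> - 2 * M)\<^sup>2" by (simp add: power2_commute)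
        then have "8 * M\<^sup>2 / (c * t) \<le> 8 * (\<bar>u (x, t)\<bar> - 2 * M)\<^sup>2 / (c * t)"
          using c t' by (intro divide_right_mono mult_left_mono) auto
        then show ?thesis using t' c by (simp add: mult_ac)
      qed
      finally show "F (nu_of u T x t)
            \<le> max (t powr (2 / 2) * exp (16 / c * 2 * (\<bar>u (x, t)\<bar> - 2 * M)\<^sup>2 / (4 * t))) (F0 + 1)"
        by (simp add: le_max_iff_disj)
    qed
  qed
  moreover have "16 / c > 0" "F0 + 1 > F (- phi0)" "(2::real) > 1" using c by (simp_all add: F0_def)
  ultimately show ?thesis by blast
qed

end
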